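(* Let $\Lambda\subset\mathbb{C}$ be a discrete sequence. The following statements are equivalent: (a) $\Lambda$ is an interpolation sequence for the Bernstein algebra $\mathcal{B}$. (b) $\Lambda$ is a free interpolation sequence for $\mathcal{B}$. (c) There exist constants $A,B,C>0$ and functions $f_\lambda\in\mathcal{B}$, $\lambda\in\Lambda$, such that $f_\lambda(\lambda')=\delta_{\lambda,\lambda'}$ (Kronecker delta) for all $\lambda,\lambda'\in\Lambda$ and $$\sup_{z\in\mathbb{C}}|f_\lambda(z)|e^{-C|\operatorname{Im} z|}\le A e^{B|\operatorname{Im}\lambda|}\qquad\text{for all }\lambda\in\Lambda.$$ (d) There exist $F\in\mathcal{B}$ and constants $\varepsilon,C>0$ such that, for all $\lambda\in\Lambda$, $F(\lambda)=0$ and $$|F'(\lambda)|\ge\varepsilon e^{-C|\operatorname{Im}\lambda|}.$$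
   Context: The Bernstein algebra $\mathcal{B}$ is the algebra of entire functions $f$ of exponential type that are bounded on the real line; equivalently, entire functions $f$ for which there exist $A,B>0$ with $\log|f(z)|\le A+B|\operatorname{Im} z|$ for all $z\in\mathbb{C}$. A discrete sequence $\Lambda$ in $\mathbb{C}$ is a sequence of distinct points with no accumulation point in $\mathbb{C}$. $\Lambda$ is an interpolation sequence for $\mathcal{B}$ if for every sequence of complex values $\{v_\lambda\}_{\lambda\in\Lambda}$ satisfying $\sup_{\lambda\in\Lambda}|v_\lambda|e^{-C|\operatorname{Im}\lambda|}<\infty$ for some $C>0$ there exists $f\in\mathcal{B}$ with $f(\lambda)=v_\lambda$ for all $\lambda\in\Lambda$. $\Lambda$ is a free interpolation sequence for $\mathcal{B}$ if the trace space $\{\{f(\lambda)\}_{\lambda\in\Lambda}: f\in\mathcal{B}\}$ is ideal, i.e. whenever $f\in\mathcal{B}$ and $\{\alpha_\lambda\}_{\lambda\in\Lambda}$ is a bounded sequence of complex numbers there exists $g\in\mathcal{B}$ with $g(\lambda)=\alpha_\lambda f(\lambda)$ for all $\lambda\in\Lambda$. (Since $\mathcal{B}$ is an algebra, this holds if and only if for every bounded sequence $\{\alpha_\lambda\}_{\lambda\in\Lambda}$ there exists $f\in\mathcal{B}$ with $f(\lambda)=\alpha_\lambda$ for all $\lambda\in\Lambda$.) *)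

theory Defs
  imports "HOL-Complex_Analysis.Complex_Analysis"
begin

definition exponential_type :: "(complex \<Rightarrow> complex) \<Rightarrow> bool" where
  "exponential_type f \<longleftrightarrow>
     (\<exists>A>0. \<exists>B>0. \<forall>z. norm (f z) \<le> A * exp (B * norm z))"

definition Bernstein_algebra :: "(complex \<Rightarrow> complex) set" where
  "Bernstein_algebra =
     {f. f holomorphic_on UNIV \<and> exponential_type f \<and> bounded (f ` \<real>)}"

text \<open>
  A sequence of distinct points is represented by the set \<open>\<Lambda>\<close> of its points; a sequence of
  values indexed by \<open>\<Lambda>\<close> is a function of which only the values on \<open>\<Lambda>\<close> matter.
\<close>

definition discrete_sequence :: "complex set \<Rightarrow> bool" where
  "discrete_sequence \<Lambda> \<longleftrightarrow> (\<forall>z. \<not> z islimpt \<Lambda>)"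

definition interpolation_sequence :: "complex set \<Rightarrow> bool" where
  "interpolation_sequence \<Lambda> \<longleftrightarrow>
     (\<forall>v :: complex \<Rightarrow> complex.
        (\<exists>C>0. bdd_above ((\<lambda>l. norm (v l) * exp (- C * \<bar>Im l\<bar>)) ` \<Lambda>)) \<longrightarrow>
        (\<exists>f\<in>Bernstein_algebra. \<forall>l\<in>\<Lambda>. f l = v l))"

definition free_interpolation_sequence :: "complex set \<Rightarrow> bool" where
  "free_interpolation_sequence \<Lambda> \<longleftrightarrow>
     (\<forall>f\<in>Bernstein_algebra. \<forall>\<alpha> :: complex \<Rightarrow> complex. bounded (\<alpha> ` \<Lambda>) \<longrightarrow>
        (\<exists>g\<in>Bernstein_algebra. \<forall>l\<in>\<Lambda>. g l = \<alpha> l * f l))"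

end

(*
  By Phragmen-Lindelof the algebra consists of the entire functions with
  |f(z)| <= K exp(C |Im z|), and for fixed K, C these form a compact family.

  (b) => (c): a Baire category argument gives a cylinder of 0/1 sequences that are interpolated
  with uniform K and C; two of them that differ only at l give f_l by subtraction.
  (d) => (c): f_l(z) = F(z) / (F'(l) (z - l)).
  (c) => (a), (d): (c) forces |l - l'| >= delta exp(-E |Im l|), so that
  sum_l exp(-(2E + 1) |Im l|) / (1 + |z - l|^2) is bounded in z. Multiplying f_l by
  exp(-+ i D (z - l)) (sin(z - l) / (z - l))^2 gives functions g_l, still biorthogonal to the
  points, for which sum v_l g_l solves the interpolation problem and
  F(z) = sum (z - l) g_l(z)^2 satisfies F(l) = 0 and F'(l) = 1.
*)
theory Submission
  imports Defs
begin

text \<open>Growth of order one is critical for a half-plane, so Phragmen-Lindelof is carried out in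
  quadrants: there any order below two is admissible, and on the imaginary axis the growth
  hypothesis is itself the boundary estimate. Baire applies in (b) => (c) because, by compactness,
  the 0/1 sequences interpolated with fixed constants form a closed set; countably many such sets
  exhaust all 0/1 sequences, so one of them has interior. Convergence of the two series in (c) =>
  (a), (d) is replaced by boundedness. Partial sums over growing balls stay in one compact family,
  so a subsequence converges together with its derivatives, and at a point of \<Lambda> the value
  and the derivative of the limit come from a single term. What remains is a weighted count of the
  points of \<Lambda>, and the separation is exactly what bounds it.\<close>

section \<open>Entire functions with controlled growth away from the real axis\<close>

definition Im_bounded :: "real \<Rightarrow> real \<Rightarrow> (complex \<Rightarrow> complex) \<Rightarrow> bool" where
  \<comment> \<open>The algebra is the union of these classes. The constants are explicit because
    (c) asserts uniformity in \<open>l\<close> and compactness holds only for fixed \<open>K\<close>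
    and \<open>C\<close>.\<close>
  "Im_bounded K C f \<longleftrightarrow> f holomorphic_on UNIV \<and> (\<forall>z. norm (f z) \<le> K * exp (C * \<bar>Im z\<bar>))"

lemma Im_bounded_holomorphic: "Im_bounded K C f \<Longrightarrow> f holomorphic_on UNIV"
  by (simp add: Im_bounded_def)

lemma Im_boundedD: "Im_bounded K C f \<Longrightarrow> norm (f z) \<le> K * exp (C * \<bar>Im z\<bar>)"
  by (simp add: Im_bounded_def)

lemma Im_bounded_nonneg: "Im_bounded K C f \<Longrightarrow> 0 \<le> K"
  using Im_boundedD[of K C f 0] by (simp add: order_trans[OF norm_ge_zero])

lemma Im_bounded_mono:
  assumes "Im_bounded K C f" "K \<le> K'" "C \<le> C'"
  shows "Im_bounded K' C' f"
  unfolding Im_bounded_def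
proof (intro conjI allI)
  fix z
  have "norm (f z) \<le> K * exp (C * \<bar>Im z\<bar>)"
    using assms by (simp add: Im_boundedD)
  also have "\<dots> \<le> K' * exp (C' * \<bar>Im z\<bar>)"
    using assms Im_bounded_nonneg[OF assms(1)] by (intro mult_mono) (auto intro: mult_right_mono)
  finally show "norm (f z) \<le> K' * exp (C' * \<bar>Im z\<bar>)" .
qed (use assms in \<open>auto simp: Im_bounded_def\<close>)

lemma Im_bounded_mult:
  assumes "Im_bounded K C f" "Im_bounded L D g"
  shows "Im_bounded (K * L) (C + D) (\<lambda>z. f z * g z)"
  unfolding Im_bounded_def
proof (intro conjI allI)
  fix z
  have "norm (f z * g z) \<le> (K * exp (C * \<bar>Im z\<bar>)) * (L * exp (D * \<bar>Im z\<bar>))"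
    unfolding norm_mult
    using Im_boundedD[OF assms(1)] Im_boundedD[OF assms(2)] Im_bounded_nonneg[OF assms(1)]
    by (intro mult_mono) auto
  then show "norm (f z * g z) \<le> K * L * exp ((C + D) * \<bar>Im z\<bar>)"
    by (simp add: algebra_simps exp_add)
qed (use assms in \<open>auto simp: Im_bounded_def intro!: holomorphic_intros\<close>)

lemma Im_bounded_diff:
  assumes "Im_bounded K C f" "Im_bounded L C g"
  shows "Im_bounded (K + L) C (\<lambda>z. f z - g z)"
  unfolding Im_bounded_def
proof (intro conjI allI)
  fix z
  show "norm (f z - g z) \<le> (K + L) * exp (C * \<bar>Im z\<bar>)"
    using Im_boundedD[OF assms(1), of z] Im_boundedD[OF assms(2), of z]
      norm_triangle_ineq4[of "f z" "g z"] by (simp add: algebra_simps)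
qed (use assms in \<open>auto simp: Im_bounded_def intro!: holomorphic_intros\<close>)

subsection \<open>A Phragmen-Lindelof principle\<close>

lemma frontier_subset_of_open_subset:
  assumes "open U" "U \<subseteq> T" "closed T"
  shows "frontier T \<subseteq> T - U"
  using assms interior_maximal[OF assms(2,1)] by (auto simp: frontier_def)

text \<open>The substitution \<open>z = u\<^sup>2\<close> replaces the quadrant by a sector on which \<open>Re ((1 - 2\<i>) u\<^sup>3) > 0\<close>,
  so that \<open>exp (- d (1 - 2\<i>) u\<^sup>3)\<close> beats any growth of order two in \<open>u\<close>.\<close>

lemma Phragmen_Lindelof_quadrant_Re_Im:
  fixes f :: "complex \<Rightarrow> complex"
  assumes f: "f holomorphic_on UNIV" and K: "0 < K" and B: "0 \<le> B"
    and growth: "\<And>z. norm (f z) \<le> K * exp (B * norm z)"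
    and axis: "\<And>x. norm (f (of_real x)) \<le> K"
    and z: "0 \<le> Re z" "0 \<le> Im z"
  shows "norm (f z) \<le> K * exp (B * Im z)"
proof -
  define w where "w = csqrt z"
  have w2: "w\<^sup>2 = z" by (simp add: w_def)
  have Rew: "0 \<le> Re w" using csqrt_principal[of z] by (auto simp: w_def)
  have ReIm: "Re z = (Re w)\<^sup>2 - (Im w)\<^sup>2" "Im z = 2 * Re w * Im w"
    by (simp_all flip: w2 add: power2_eq_square algebra_simps)
  have Imw: "0 \<le> Im w"
  proof (rule ccontr)
    assume "\<not> 0 \<le> Im w"
    with ReIm z Rew have "Re w = 0" by (smt (verit) mult_nonneg_nonneg mult_pos_neg)
    with ReIm z \<open>\<not> 0 \<le> Im w\<close> show False by simp
  qed
  have Imw': "Im w \<le> Re w"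
    using ReIm z Rew by (auto intro: power2_le_imp_le)
  \<comment> \<open>The middle factor has modulus \<open>exp (- B * Im z)\<close>. It turns the
    claim into a bound by \<open>K\<close>, and on the ray over the imaginary axis, where
    \<open>norm (u\<^sup>2) = Im (u\<^sup>2)\<close>, it cancels the growth exactly. The last factor
    is the damping, removed at the end by letting \<open>d\<close> tend to 0.\<close>
  have bound: "norm (f (w\<^sup>2) * exp (\<i> * of_real B * w\<^sup>2) * exp (- (of_real d * (1 - 2*\<i>) * w^3))) \<le> K"
    if d: "0 < d" for d :: real
  proof -
    define G where "G u = f (u\<^sup>2) * exp (\<i> * of_real B * u\<^sup>2) * exp (- (of_real d * (1 - 2*\<i>) * u^3))" for u
    \<comment> \<open>\<open>Re w\<close> places \<open>w\<close> in the triangle \<open>T\<close>;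
      \<open>2 * B / d\<close> gives \<open>2 * B \<le> d * R\<close>, so that on the side
      \<open>Re u = R\<close> the growth exponent, at most \<open>2 * B * R\<^sup>2\<close>, is
      beaten by \<open>d * R^3\<close>.\<close>
    define R where "R = max (Re w) (2 * B / d)"
    define T where "T = {u. 0 \<le> Im u \<and> Im u \<le> Re u \<and> Re u \<le> R}"
    define U where "U = {u. 0 < Im u \<and> Im u < Re u \<and> Re u < R}"
    have clT: "closed T"
      unfolding T_def by (intro closed_Collect_conj closed_Collect_le continuous_intros)
    have opU: "open U"
      unfolding U_def by (intro open_Collect_conj open_Collect_less continuous_intros)
    have bdT: "bounded T"
    proof (rule boundedI[where B="2 * R"])
      fix u assume "u \<in> T"
      then show "norm u \<le> 2 * R" using cmod_le[of u] by (auto simp: T_def)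
    qed
    have R: "0 \<le> R" using Rew by (auto simp: R_def)
    \<comment> \<open>On the sector the argument of \<open>u^3\<close> runs from 0 to 135 degrees;
      the factor \<open>1 - 2*\<i>\<close>, of argument about -63 degrees, turns this range into the
      open right half-plane.\<close>
    have cube: "(Re u)^3 \<le> Re ((1 - 2*\<i>) * u^3)" if "0 \<le> Im u" "Im u \<le> Re u" for u
    proof -
      obtain a b where u: "u = Complex a b" by (cases u)
      have ab: "0 \<le> b" "b \<le> a" using that u by auto
      have "Re ((1 - 2*\<i>) * u^3) = a^3 + (6*a^2*b - 3*a*b^2 - 2*b^3)"
        by (simp add: u power3_eq_cube power2_eq_square algebra_simps)
      moreover have "b * b \<le> a * a" "a * b \<le> a * a" using ab by (auto intro: mult_mono)
      then have "0 \<le> b * (6 * (a*a) - 3 * (a*b) - 2 * (b*b))"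
        using ab by (intro mult_nonneg_nonneg) (auto, smt (verit) zero_le_mult_iff)
      then have "0 \<le> 6*a^2*b - 3*a*b^2 - 2*b^3"
        by (simp add: power3_eq_cube power2_eq_square algebra_simps)
      ultimately show ?thesis by (simp add: u)
    qed
    have nG: "norm (G u) = norm (f (u\<^sup>2)) * exp (- B * Im (u\<^sup>2)) * exp (- d * Re ((1 - 2*\<i>) * u^3))" for u
    proof -
      have "Re (\<i> * of_real B * u\<^sup>2) = - B * Im (u\<^sup>2)"
        "Re (- (of_real d * (1 - 2*\<i>) * u^3)) = - d * Re ((1 - 2*\<i>) * u^3)"
        unfolding mult.assoc[of "of_real d"] by simp_all
      then show ?thesis unfolding G_def norm_mult norm_exp_eq_Re by simp
    qed
    have "frontier T \<subseteq> T - U"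
      by (rule frontier_subset_of_open_subset[OF opU _ clT]) (auto simp: T_def U_def)
    then have frT: "frontier T \<subseteq> {u. 0 \<le> Im u \<and> Im u \<le> Re u \<and> Re u \<le> R \<and>
        (Im u = 0 \<or> Im u = Re u \<or> Re u = R)}"
      by (auto simp: T_def U_def)
    have fr: "norm (G u) \<le> K" if "u \<in> frontier T" for u
    proof -
      have uT: "0 \<le> Im u" "Im u \<le> Re u" "Re u \<le> R"
        and cs: "Im u = 0 \<or> Im u = Re u \<or> Re u = R"
        using that frT by auto
      have e3: "exp (- d * Re ((1 - 2*\<i>) * u^3)) \<le> exp (- d * (Re u)^3)"
        using cube[OF uT(1,2)] d by simp
      also have "\<dots> \<le> 1" using d uT by simp
      finally have e1: "exp (- d * Re ((1 - 2*\<i>) * u^3)) \<le> 1" .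
      have n2: "norm (u\<^sup>2) = (Re u)\<^sup>2 + (Im u)\<^sup>2"
        by (simp add: norm_power cmod_power2)
      have i2: "Im (u\<^sup>2) = 2 * Re u * Im u"
        by (simp add: power2_eq_square)
      consider "Im u = 0" | "Im u = Re u" | "Re u = R" using cs by blast
      then show ?thesis
      proof cases
        case 1
        then have "u\<^sup>2 = of_real ((Re u)\<^sup>2)" by (simp add: complex_eq_iff power2_eq_square)
        then have "norm (f (u\<^sup>2)) \<le> K" "Im (u\<^sup>2) = 0" using axis by (metis, simp)
        then have "norm (f (u\<^sup>2)) * exp (- B * Im (u\<^sup>2)) \<le> K" by simp
        from mult_mono[OF this e1] show ?thesis using K by (simp add: nG)
      next
        case 2
        then have n: "norm (u\<^sup>2) = Im (u\<^sup>2)" unfolding n2 i2 by (simp add: power2_eq_square)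
        have "norm (f (u\<^sup>2)) * exp (- B * Im (u\<^sup>2)) \<le> K * exp (B * norm (u\<^sup>2)) * exp (- B * Im (u\<^sup>2))"
          by (intro mult_right_mono growth) auto
        also have "\<dots> = K" 
          unfolding n by (simp add: exp_minus)
        finally have "norm (f (u\<^sup>2)) * exp (- B * Im (u\<^sup>2)) \<le> K" .
        from mult_mono[OF this e1] show ?thesis using K by (simp add: nG)
      next
        case 3
        have a: "norm (f (u\<^sup>2)) * exp (- B * Im (u\<^sup>2)) \<le> K * exp (B * norm (u\<^sup>2)) * 1"
          by (intro mult_mono growth) (use K B uT i2 in auto)
        have "norm (G u) \<le> (K * exp (B * norm (u\<^sup>2)) * 1) * exp (- d * (Re u)^3)"
          unfolding nG by (rule mult_mono[OF a e3]) (use K in auto)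
        also have "\<dots> = K * exp (B * ((Re u)\<^sup>2 + (Im u)\<^sup>2) - d * (Re u)^3)"
          by (simp add: n2 exp_diff exp_minus field_simps)
        also have "\<dots> \<le> K * exp 0"
        proof (intro mult_left_mono)
          have "(Im u)\<^sup>2 \<le> (Re u)\<^sup>2" using uT by (intro power_mono) auto
          then have "B * ((Re u)\<^sup>2 + (Im u)\<^sup>2) \<le> B * (2 * R\<^sup>2)"
            using B 3 by (intro mult_left_mono) auto
          also have "\<dots> \<le> (d * R) * R\<^sup>2"
          proof -
            have "2 * B \<le> d * R" using d by (auto simp: R_def field_simps max_def)
            then show ?thesis using mult_right_mono[of "2*B" "d*R" "R\<^sup>2"] by simp
          qed
          finally show "exp (B * ((Re u)\<^sup>2 + (Im u)\<^sup>2) - d * (Re u)^3) \<le> exp 0"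
            using 3 by (simp add: power3_eq_cube power2_eq_square mult.assoc)
        qed (use K in auto)
        finally show ?thesis by simp
      qed
    qed
    have holG: "G holomorphic_on UNIV"
    proof -
      have "(f \<circ> (\<lambda>u. u\<^sup>2)) holomorphic_on UNIV"
        by (intro holomorphic_on_compose_gen[OF _ f] holomorphic_intros) auto
      then show ?thesis unfolding G_def o_def by (intro holomorphic_intros)
    qed
    have "norm (G w) \<le> K"
    proof (rule maximum_modulus_frontier[of G T])
      show "G holomorphic_on interior T" "continuous_on (closure T) G"
        using holG by (auto intro: holomorphic_on_subset holomorphic_on_imp_continuous_on)
      show "w \<in> T" using Rew Imw Imw' by (auto simp: T_def R_def)
    qed (use bdT fr in auto)
    then show ?thesis by (simp add: G_def)
  qed
  define H where "H d = norm (f (w\<^sup>2) * exp (\<i> * of_real B * w\<^sup>2) * exp (- (of_real d * (1 - 2*\<i>) * w^3)))" for d :: real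
  have "(H \<longlongrightarrow> H 0) (at_right 0)"
  proof -
    have "isCont H 0" unfolding H_def by (intro continuous_intros)
    then show ?thesis by (meson continuous_within filterlim_at_split)
  qed
  moreover have "eventually (\<lambda>d. H d \<le> K) (at_right 0)"
    using bound by (auto simp: H_def eventually_at_filter)
  ultimately have "H 0 \<le> K"
    by (intro tendsto_upperbound) auto
  then have "norm (f z) * exp (- B * Im z) \<le> K"
    by (simp add: H_def w2 norm_mult)
  then show ?thesis by (simp add: exp_minus field_simps)
qed

text \<open>The other quadrants reduce to the first by the reflection
  \<open>u \<mapsto> cnj (g (- cnj u))\<close> in the imaginary axis and by
  \<open>z \<mapsto> - z\<close>, both of which preserve the hypotheses.\<close>

lemma Phragmen_Lindelof_Im:
  fixes f :: "complex \<Rightarrow> complex"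
  assumes f: "f holomorphic_on UNIV" and K: "0 < K" and B: "0 \<le> B"
    and growth: "\<And>z. norm (f z) \<le> K * exp (B * norm z)"
    and axis: "\<And>x. norm (f (of_real x)) \<le> K"
  shows "norm (f z) \<le> K * exp (B * \<bar>Im z\<bar>)"
proof -
  have upper: "norm (g z) \<le> K * exp (B * \<bar>Im z\<bar>)"
    if g: "g holomorphic_on UNIV" and gr: "\<And>z. norm (g z) \<le> K * exp (B * norm z)"
      and ax: "\<And>x. norm (g (of_real x)) \<le> K" and z: "0 \<le> Im z" for g z
  proof (cases "0 \<le> Re z")
    case True
    then show ?thesis
      using Phragmen_Lindelof_quadrant_Re_Im[OF g K B gr ax True z] z by simp
  next
    case False
    define h where "h u = cnj (g (- cnj u))" for u
    have "(cnj \<circ> (g \<circ> uminus) \<circ> cnj) holomorphic_on UNIV"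
      by (intro holomorphic_on_compose_cnj_cnj holomorphic_on_compose_gen[OF _ g])
         (auto intro!: holomorphic_intros)
    then have h: "h holomorphic_on UNIV" by (simp add: h_def[abs_def] o_def)
    have gr': "norm (h u) \<le> K * exp (B * norm u)" for u
      using gr[of "- cnj u"] by (simp add: h_def)
    have ax': "norm (h (of_real x)) \<le> K" for x
      using ax[of "- x"] by (simp add: h_def)
    show ?thesis
      using Phragmen_Lindelof_quadrant_Re_Im[OF h K B gr' ax', of "- cnj z"] False z
      by (simp add: h_def)
  qed
  show ?thesis
  proof (cases "0 \<le> Im z")
    case True
    then show ?thesis by (intro upper f growth axis)
  next
    case False
    have "(f \<circ> uminus) holomorphic_on UNIV"
      by (intro holomorphic_on_compose_gen[OF _ f] holomorphic_intros) auto
    from upper[OF this, of "- z"] False growth[of "- _"] axis[of "- _"]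
    show ?thesis by (simp del: of_real_minus add: of_real_minus[symmetric])
  qed
qed

text \<open>Phragmen-Lindelof keeps the exponent, so the type \<open>B\<close> becomes the
  \<open>C\<close> of the class, while \<open>K\<close> has to dominate both the growth constant and
  the bound on the real axis.\<close>

lemma Bernstein_algebra_iff_Im_bounded:
  "f \<in> Bernstein_algebra \<longleftrightarrow> (\<exists>K>0. \<exists>C>0. Im_bounded K C f)"
proof
  assume "f \<in> Bernstein_algebra"
  then obtain A B M where h: "f holomorphic_on UNIV" and "A > 0" and B: "B > 0"
    and A: "\<And>z. norm (f z) \<le> A * exp (B * norm z)"
    and M: "\<And>x. x \<in> \<real> \<Longrightarrow> norm (f x) \<le> M"
    by (auto simp: Bernstein_algebra_def exponential_type_def bounded_iff)
  define K where "K = max A M"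
  have K: "K > 0" using \<open>A > 0\<close> by (auto simp: K_def)
  have "norm (f z) \<le> K * exp (B * norm z)" for z
  proof -
    have "A * exp (B * norm z) \<le> K * exp (B * norm z)"
      by (intro mult_right_mono) (auto simp: K_def)
    with A[of z] show ?thesis by linarith
  qed
  moreover have "norm (f (of_real x)) \<le> K" for x
    using M[of "of_real x"] by (auto simp: K_def)
  ultimately have "Im_bounded K B f"
    using Phragmen_Lindelof_Im[OF h K] B by (auto simp: Im_bounded_def h)
  then show "\<exists>K>0. \<exists>C>0. Im_bounded K C f" using K B by blast
next
  assume "\<exists>K>0. \<exists>C>0. Im_bounded K C f"
  then obtain K C where K: "K > 0" and C: "C > 0" and f: "Im_bounded K C f" by blast
  have "norm (f z) \<le> K * exp (C * norm z)" for z
  proof -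
    have "K * exp (C * \<bar>Im z\<bar>) \<le> K * exp (C * norm z)"
      using K C abs_Im_le_cmod[of z] by simp
    with Im_boundedD[OF f, of z] show ?thesis by linarith
  qed
  moreover have "bounded (f ` \<real>)"
  proof (rule boundedI)
    fix w assume "w \<in> f ` \<real>"
    then obtain x where "w = f (of_real x)" by (auto elim: Reals_cases)
    then show "norm w \<le> K" using Im_boundedD[OF f, of "of_real x"] by simp
  qed
  ultimately show "f \<in> Bernstein_algebra"
    using f K C by (auto simp: Bernstein_algebra_def exponential_type_def Im_bounded_def)
qed

subsection \<open>Division by a zero and normal families\<close>

text \<open>At distance at least 1 from \<open>a\<close>, dividing by \<open>z - a\<close> cannot
  enlarge \<open>F\<close>. Inside the unit disc the maximum principle moves the estimate to the
  circle, whose points lie within 2 of \<open>z\<close>; hence the factor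
  \<open>exp (2 * C)\<close>.\<close>

lemma Im_bounded_quotient:
  assumes F: "Im_bounded K C F" and C: "0 \<le> C" and a: "F a = 0"
  obtains q where "Im_bounded (K * exp (2 * C)) C q" "\<And>z. F z = (z - a) * q z" "q a = deriv F a"
proof -
  define q where "q z = (if z = a then deriv F a else (F z - F a) / (z - a))" for z
  have hol: "q holomorphic_on UNIV"
    unfolding q_def by (intro pole_lemma_open Im_bounded_holomorphic[OF F]) auto
  have K: "0 \<le> K" by (rule Im_bounded_nonneg[OF F])
  have far: "norm (q z) \<le> K * exp (C * \<bar>Im z\<bar>)" if "1 \<le> dist a z" for z
  proof -
    have nz: "1 \<le> norm (z - a)" using that by (simp add: dist_norm norm_minus_commute)
    then have "norm (q z) = norm (F z) / norm (z - a)" by (auto simp: q_def a norm_divide)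
    also have "\<dots> \<le> norm (F z) / 1" using nz by (intro divide_left_mono) auto
    also have "\<dots> \<le> K * exp (C * \<bar>Im z\<bar>)" using Im_boundedD[OF F] by simp
    finally show ?thesis .
  qed
  have "norm (q z) \<le> K * exp (2 * C) * exp (C * \<bar>Im z\<bar>)" for z
  proof (cases "1 \<le> dist a z")
    case True
    have "K * exp (C * \<bar>Im z\<bar>) \<le> K * exp (2 * C) * exp (C * \<bar>Im z\<bar>)"
      using K C by (intro mult_right_mono) (auto simp: mult_le_cancel_left1)
    with far[OF True] show ?thesis by linarith
  next
    case False
    show ?thesis
    proof (rule maximum_modulus_frontier[of q "cball a 1"])
      fix w assume "w \<in> frontier (cball a 1)"
      then have w: "dist a w = 1" by (simp add: sphere_def)
      have "dist w z \<le> 2" using dist_triangle[of w z a] w False by (simp add: dist_commute)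
      then have "\<bar>Im (w - z)\<bar> \<le> 2" using abs_Im_le_cmod[of "w - z"] by (simp add: dist_norm)
      then have "\<bar>Im w\<bar> \<le> 2 + \<bar>Im z\<bar>" by simp
      then have "C * \<bar>Im w\<bar> \<le> 2 * C + C * \<bar>Im z\<bar>"
        using mult_left_mono[OF _ C] by (fastforce simp: algebra_simps)
      then have "K * exp (C * \<bar>Im w\<bar>) \<le> K * exp (2 * C + C * \<bar>Im z\<bar>)"
        using K by (intro mult_left_mono) auto
      then show "norm (q w) \<le> K * exp (2 * C) * exp (C * \<bar>Im z\<bar>)"
        using far[of w] w by (simp add: exp_add)
    qed (use False hol in \<open>auto intro: holomorphic_on_subset holomorphic_on_imp_continuous_on\<close>)
  qed
  then have "Im_bounded (K * exp (2 * C)) C q" using hol by (simp add: Im_bounded_def)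
  moreover have "F z = (z - a) * q z" for z using a by (simp add: q_def)
  moreover have "q a = deriv F a" by (simp add: q_def)
  ultimately show ?thesis by (rule that)
qed

text \<open>The bound is locally uniform, so Montel applies, and it survives pointwise limits, so
  the limit keeps the same constants. Convergence of the derivatives serves (d).\<close>

lemma Im_bounded_normal_family:
  assumes F: "\<And>n. Im_bounded K C (F n)"
  obtains f r where "Im_bounded K C f" "strict_mono (r :: nat \<Rightarrow> nat)"
    "\<And>z. (\<lambda>n. F (r n) z) \<longlonglongrightarrow> f z" "\<And>z. (\<lambda>n. deriv (F (r n)) z) \<longlonglongrightarrow> deriv f z"
proof -
  have "\<exists>B. \<forall>h\<in>{h. Im_bounded K C h}. \<forall>z\<in>S. norm (h z) \<le> B" if S: "compact S" for S
  proof -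
    have "bounded ((\<lambda>z. K * exp (C * \<bar>Im z\<bar>)) ` S)"
      by (intro compact_imp_bounded compact_continuous_image continuous_intros S)
    then obtain B where "\<And>z. z \<in> S \<Longrightarrow> \<bar>K * exp (C * \<bar>Im z\<bar>)\<bar> \<le> B"
      by (auto simp: bounded_iff)
    then show ?thesis
      by (intro exI[of _ B] ballI) (smt (verit) Im_boundedD mem_Collect_eq)
  qed
  then obtain f r where f: "f holomorphic_on UNIV" and r: "strict_mono (r :: nat \<Rightarrow> nat)"
    and lim: "\<And>z. (\<lambda>n. F (r n) z) \<longlonglongrightarrow> f z"
    and ulim: "\<And>S. compact S \<Longrightarrow> uniform_limit S (F \<circ> r) f sequentially"
    using F by (rule_tac Montel[of UNIV "{h. Im_bounded K C h}" F]) (auto dest: Im_bounded_holomorphic)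
  have "norm (f z) \<le> K * exp (C * \<bar>Im z\<bar>)" for z
    using tendsto_norm[OF lim[of z]] by (rule tendsto_upperbound) (auto intro!: always_eventually Im_boundedD[OF F])
  moreover have "(\<lambda>n. deriv (F (r n)) z) \<longlonglongrightarrow> deriv f z" for z
  proof (rule deriv_complex_uniform_limit[where A = "ball z 1"])
    show "uniform_limit (ball z 1) (\<lambda>n. F (r n)) f sequentially"
      using ulim[of "cball z 1"] uniform_limit_on_subset[where I = "ball z 1" and J = "cball z 1"]
      by (auto simp: o_def)
    show "\<forall>\<^sub>F n in sequentially. F (r n) holomorphic_on ball z 1"
      by (intro always_eventually allI holomorphic_on_subset[OF Im_bounded_holomorphic[OF F]]) auto
  qed auto
  ultimately show ?thesis using that[of f r] f r lim by (auto simp: Im_bounded_def)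
qed

subsection \<open>Sums over separated sequences\<close>

lemma sum_int_inverse_square_bounded:
  "\<exists>S>0. \<forall>T::int set. finite T \<longrightarrow> (\<Sum>n\<in>T. 1 / (1 + (of_int n)\<^sup>2)) \<le> (S :: real)"
proof -
  define h where "h k = 1 / (1 + (real k)\<^sup>2)" for k :: nat
  have h0: "0 \<le> h k" for k by (simp add: h_def)
  have sm: "summable h"
  proof (rule summable_comparison_test')
    show "summable (\<lambda>k. inverse ((real k)\<^sup>2))" by (rule inverse_power_summable) simp
    show "norm (h k) \<le> inverse ((real k)\<^sup>2)" if "k \<ge> 1" for k
      using that unfolding h_def by (simp add: divide_inverse le_imp_inverse_le)
  qed
  have part: "(\<Sum>n\<in>T. h (nat \<bar>n\<bar>)) \<le> suminf h"
    if "finite T" "inj_on (\<lambda>n. nat \<bar>n\<bar>) T" for T :: "int set"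
    using sum_le_suminf[OF sm, of "(\<lambda>n. nat \<bar>n\<bar>) ` T"] that h0
    by (simp add: sum.reindex)
  have "(\<Sum>n\<in>T. 1 / (1 + (of_int n)\<^sup>2)) \<le> 2 * suminf h + 1" if T: "finite T" for T :: "int set"
  proof -
    have "(\<Sum>n\<in>T. 1 / (1 + (of_int n)\<^sup>2)) = (\<Sum>n\<in>T. h (nat \<bar>n\<bar>))"
      by (simp add: h_def)
    also have "\<dots> = (\<Sum>n\<in>T \<inter> {0..}. h (nat \<bar>n\<bar>)) + (\<Sum>n\<in>T - {0..}. h (nat \<bar>n\<bar>))"
      using T by (rule sum.Int_Diff)
    also have "\<dots> \<le> suminf h + suminf h"
      using T by (intro add_mono part) (auto simp: inj_on_def)
    finally show ?thesis by simp
  qed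
  then show ?thesis using suminf_nonneg[OF sm h0] by (intro exI[of _ "2 * suminf h + 1"]) simp
qed

text \<open>The gap may shrink exponentially in \<open>Im l\<close>, so a unit square may hold of
  the order of \<open>exp (2 * E * \<bar>Im l\<bar>)\<close> points. Hence the weight exponent
  \<open>2 * E + 1\<close> below: \<open>2 * E\<close> offsets the number of points, and the 1 makes
  the sum over rows converge.\<close>

definition exp_separated :: "real \<Rightarrow> real \<Rightarrow> complex set \<Rightarrow> bool" where
  "exp_separated \<delta> E \<Lambda> \<longleftrightarrow>
     (\<forall>l\<in>\<Lambda>. \<forall>l'\<in>\<Lambda>. l \<noteq> l' \<longrightarrow> \<delta> * exp (- E * \<bar>Im l\<bar>) \<le> dist l l')"

text \<open>Cut the square into boxes of side \<open>s\<close>: two points of one box differ by less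
  than \<open>s\<close> in each coordinate, hence by less than \<open>2 * s\<close>. As
  \<open>1 / s\<close> need not be an integer, each direction may need \<open>N + 1\<close> boxes,
  and \<open>N + 1 \<le> 2 / s\<close>.\<close>

lemma card_separated_square_le:
  fixes S :: "complex set"
  assumes S: "finite S" and s: "0 < s" "s \<le> 1"
    and sep: "\<And>l l'. l \<in> S \<Longrightarrow> l' \<in> S \<Longrightarrow> l \<noteq> l' \<Longrightarrow> 2 * s \<le> dist l l'"
    and cell: "\<And>l. l \<in> S \<Longrightarrow> a \<le> Re l \<and> Re l < a + 1 \<and> b \<le> Im l \<and> Im l < b + 1"
  shows "real (card S) \<le> (2 / s)\<^sup>2"
proof -
  define \<phi> where "\<phi> l = (\<lfloor>(Re l - a) / s\<rfloor>, \<lfloor>(Im l - b) / s\<rfloor>)" for l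
  define N where "N = \<lfloor>1 / s\<rfloor>"
  have N: "0 \<le> N" using s by (simp add: N_def)
  have floor_close: "\<bar>x - y\<bar> < s" if "\<lfloor>x / s\<rfloor> = \<lfloor>y / s\<rfloor>" for x y :: real
  proof -
    have "\<bar>x / s - y / s\<bar> < 1" using that by linarith
    then have "\<bar>x - y\<bar> / s < 1" using s by (simp add: abs_divide flip: diff_divide_distrib)
    then show ?thesis using s by simp
  qed
  have "inj_on \<phi> S"
  proof (rule inj_onI, rule ccontr)
    fix l l' assume l: "l \<in> S" "l' \<in> S" "\<phi> l = \<phi> l'" "l \<noteq> l'"
    then have "\<bar>Re (l - l')\<bar> < s" "\<bar>Im (l - l')\<bar> < s"
      using floor_close[of "Re l - a" "Re l' - a"] floor_close[of "Im l - b" "Im l' - b"]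
      by (auto simp: \<phi>_def)
    then have "dist l l' < 2 * s" using cmod_le[of "l - l'"] by (simp add: dist_norm)
    with sep[of l l'] l show False by simp
  qed
  moreover have "\<phi> ` S \<subseteq> {0..N} \<times> {0..N}"
  proof -
    have "0 \<le> \<lfloor>x / s\<rfloor> \<and> \<lfloor>x / s\<rfloor> \<le> N" if "0 \<le> x" "x < 1" for x
      using that s by (auto simp: N_def intro!: floor_mono divide_right_mono)
    then show ?thesis using cell by (force simp: \<phi>_def)
  qed
  ultimately have "card S \<le> card ({0..N} \<times> {0..N})"
    by (intro card_inj_on_le) auto
  also have "\<dots> = (nat (N + 1))\<^sup>2"
    by (simp add: card_cartesian_product power2_eq_square)
  finally have "real (card S) \<le> (real (nat (N + 1)))\<^sup>2"
    by (metis of_nat_le_iff of_nat_power)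
  also have "real (nat (N + 1)) = real_of_int N + 1"
    using N by simp
  also have "(real_of_int N + 1)\<^sup>2 \<le> (2 / s)\<^sup>2"
  proof (intro power_mono)
    have "real_of_int N \<le> 1 / s" unfolding N_def by (rule of_int_floor_le)
    moreover have "1 \<le> 1 / s" using s by simp
    ultimately show "real_of_int N + 1 \<le> 2 / s" by simp
  qed (use N in auto)
  finally show ?thesis .
qed

text \<open>Count times weight leaves \<open>exp (- \<bar>of_int m\<bar>)\<close>, so the bound
  takes a product form that can be summed over all cells. In \<open>96 = 16 * 3 * 2\<close> the 16
  comes from the count, 3 from comparing \<open>of_int n\<close> with \<open>Re l - x\<close>, and 2
  from the quadratic lower bound for \<open>exp\<close>. The factor \<open>exp (4 * E + 1)\<close>
  pays for \<open>\<bar>Im l\<bar>\<close> being known only up to 1.\<close>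

lemma exp_separated_cell_sum_le:
  fixes \<Lambda> :: "complex set" and x :: real and n m :: int
  assumes sep: "exp_separated \<delta> E \<Lambda>" and \<delta>: "0 < \<delta>" "\<delta> \<le> 1" and E: "0 \<le> E"
    and S: "finite S" "S \<subseteq> \<Lambda>"
    and cell: "\<And>l. l \<in> S \<Longrightarrow> \<lfloor>Re l - x\<rfloor> = n \<and> \<lfloor>Im l\<rfloor> = m"
  shows "(\<Sum>l\<in>S. exp (- (2 * E + 1) * \<bar>Im l\<bar>) / (1 + (Re l - x)\<^sup>2))
    \<le> (96 / \<delta>\<^sup>2 * exp (4 * E + 1)) * (1 / (1 + (of_int n)\<^sup>2) * (1 / (1 + (of_int m)\<^sup>2)))"
proof -
  \<comment> \<open>Half the separation that holds throughout row \<open>m\<close>, where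
    \<open>\<bar>Im l\<bar> \<le> \<bar>of_int m\<bar> + 1\<close>.\<close>
  define s where "s = \<delta> / 2 * exp (- E * (\<bar>of_int m\<bar> + 1))"
  have cell': "of_int n \<le> Re l - x \<and> Re l - x < of_int n + 1 \<and> of_int m \<le> Im l \<and> Im l < of_int m + 1"
    if "l \<in> S" for l
    using cell[OF that] by linarith
  have s0: "0 < s" using \<delta> by (simp add: s_def)
  have "exp (- E * (\<bar>of_int m\<bar> + 1)) \<le> 1" using E by simp
  then have "s \<le> 1 / 2 * 1" unfolding s_def using \<delta> by (intro mult_mono) auto
  then have s1: "s \<le> 1" by simp
  have "real (card S) \<le> (2 / s)\<^sup>2"
  proof (rule card_separated_square_le[OF S(1) s0 s1])
    fix l l' assume l: "l \<in> S" "l' \<in> S" "l \<noteq> l'"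
    have "\<bar>Im l\<bar> \<le> \<bar>of_int m\<bar> + 1" using cell'[OF l(1)] by linarith
    then have "E * \<bar>Im l\<bar> \<le> E * (\<bar>of_int m\<bar> + 1)" using E by (rule mult_left_mono)
    then have "2 * s \<le> \<delta> * exp (- E * \<bar>Im l\<bar>)" using \<delta> by (simp add: s_def)
    also have "\<dots> \<le> dist l l'" using sep l S by (auto simp: exp_separated_def)
    finally show "2 * s \<le> dist l l'" .
  next
    fix l assume "l \<in> S"
    then show "x + of_int n \<le> Re l \<and> Re l < x + of_int n + 1 \<and> of_int m \<le> Im l \<and> Im l < of_int m + 1"
      using cell'[of l] by linarith
  qed
  also have "(2 / s)\<^sup>2 = 16 / \<delta>\<^sup>2 * exp (2 * E * (\<bar>of_int m\<bar> + 1))"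
    by (simp add: s_def power_divide power_mult_distrib exp_minus divide_simps flip: exp_double)
  finally have cardS: "real (card S) \<le> 16 / \<delta>\<^sup>2 * exp (2 * E * (\<bar>of_int m\<bar> + 1))" .
  have term_le: "exp (- (2 * E + 1) * \<bar>Im l\<bar>) / (1 + (Re l - x)\<^sup>2)
      \<le> exp (- (2 * E + 1) * (\<bar>of_int m\<bar> - 1)) * (3 / (1 + (of_int n)\<^sup>2))" if l: "l \<in> S" for l
  proof -
    define t where "t = Re l - x"
    have "\<bar>of_int m\<bar> - 1 \<le> \<bar>Im l\<bar>" using cell'[OF l] by linarith
    then have "(2 * E + 1) * (\<bar>of_int m\<bar> - 1) \<le> (2 * E + 1) * \<bar>Im l\<bar>"
      using E by (intro mult_left_mono) auto
    then have e: "exp (- (2 * E + 1) * \<bar>Im l\<bar>) \<le> exp (- (2 * E + 1) * (\<bar>of_int m\<bar> - 1))"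
      unfolding exp_le_cancel_iff mult_minus_left neg_le_iff_le .
    have "\<bar>of_int n\<bar> \<le> \<bar>t\<bar> + 1" using cell'[OF l] unfolding t_def by linarith
    then have "(of_int n)\<^sup>2 \<le> (\<bar>t\<bar> + 1)\<^sup>2" by (simp add: abs_le_square_iff[symmetric])
    also have "\<dots> \<le> 2 * t\<^sup>2 + 2"
      using zero_le_power2[of "\<bar>t\<bar> - 1"] by (simp add: power2_eq_square algebra_simps)
    finally have "1 + (of_int n)\<^sup>2 \<le> 3 * (1 + t\<^sup>2)"
      using zero_le_power2[of t] unfolding distrib_left by linarith
    then have "1 / (1 + t\<^sup>2) \<le> 3 / (1 + (of_int n)\<^sup>2)"
      by (simp add: divide_simps add_pos_nonneg)
    with e show ?thesis
      unfolding t_def divide_inverse[of "exp _"] using mult_mono[OF e, of "inverse (1 + (Re l - x)\<^sup>2)"]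
      by (simp add: divide_inverse)
  qed
  have "(\<Sum>l\<in>S. exp (- (2 * E + 1) * \<bar>Im l\<bar>) / (1 + (Re l - x)\<^sup>2))
      \<le> real (card S) * (exp (- (2 * E + 1) * (\<bar>of_int m\<bar> - 1)) * (3 / (1 + (of_int n)\<^sup>2)))"
    using term_le by (rule sum_bounded_above)
  also have "\<dots> \<le> (16 / \<delta>\<^sup>2 * exp (2 * E * (\<bar>of_int m\<bar> + 1)))
      * (exp (- (2 * E + 1) * (\<bar>of_int m\<bar> - 1)) * (3 / (1 + (of_int n)\<^sup>2)))"
    using cardS by (intro mult_right_mono) (auto intro!: divide_nonneg_pos add_pos_nonneg)
  also have "\<dots> = (48 / \<delta>\<^sup>2 * (1 / (1 + (of_int n)\<^sup>2)))
      * (exp (2 * E * (\<bar>of_int m\<bar> + 1)) * exp (- (2 * E + 1) * (\<bar>of_int m\<bar> - 1)))"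
    by (simp add: mult_ac)
  also have "exp (2 * E * (\<bar>of_int m\<bar> + 1)) * exp (- (2 * E + 1) * (\<bar>of_int m\<bar> - 1))
      = exp (4 * E + 1) * exp (- \<bar>of_int m\<bar>)"
    unfolding exp_add[symmetric] by (simp add: algebra_simps)
  also have "(48 / \<delta>\<^sup>2 * (1 / (1 + (of_int n)\<^sup>2))) * (exp (4 * E + 1) * exp (- \<bar>of_int m\<bar>))
      \<le> (48 / \<delta>\<^sup>2 * (1 / (1 + (of_int n)\<^sup>2))) * (exp (4 * E + 1) * (2 / (1 + (of_int m)\<^sup>2)))"
  proof (intro mult_left_mono)
    have "1 + \<bar>of_int m\<bar> + \<bar>of_int m\<bar>\<^sup>2 / 2 \<le> exp (\<bar>of_int m\<bar> :: real)"
      by (rule exp_lower_Taylor_quadratic) simp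
    then have "(1 + (of_int m)\<^sup>2) / 2 \<le> exp (\<bar>of_int m\<bar> :: real)" by simp
    then have "inverse (exp (\<bar>of_int m\<bar> :: real)) \<le> inverse ((1 + (of_int m)\<^sup>2) / 2)"
      by (intro le_imp_inverse_le) (auto intro!: divide_pos_pos add_pos_nonneg)
    then show "exp (- \<bar>of_int m\<bar>) \<le> 2 / (1 + (of_int m :: real)\<^sup>2)"
      by (simp add: exp_minus)
  qed (auto intro!: divide_nonneg_pos add_pos_nonneg mult_nonneg_nonneg)
  also have "\<dots> = (96 / \<delta>\<^sup>2 * exp (4 * E + 1)) * (1 / (1 + (of_int n)\<^sup>2) * (1 / (1 + (of_int m)\<^sup>2)))"
    by (simp add: mult_ac)
  finally show ?thesis .
qed

text \<open>Uniformity in \<open>x\<close> matters: \<open>x\<close> becomes \<open>Re z\<close>,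
  and \<open>M\<close> enters a bound valid for all \<open>z\<close>.\<close>

lemma exp_separated_sum_bounded:
  assumes sep: "exp_separated \<delta> E \<Lambda>" and \<delta>: "0 < \<delta>" "\<delta> \<le> 1" and E: "0 \<le> E"
  shows "\<exists>M>0. \<forall>S x. finite S \<longrightarrow> S \<subseteq> \<Lambda> \<longrightarrow>
      (\<Sum>l\<in>S. exp (- (2 * E + 1) * \<bar>Im l\<bar>) / (1 + (Re l - x)\<^sup>2)) \<le> M"
proof -
  obtain Z :: real where Z: "0 < Z" "\<And>T::int set. finite T \<Longrightarrow> (\<Sum>n\<in>T. 1 / (1 + (of_int n)\<^sup>2)) \<le> Z"
    using sum_int_inverse_square_bounded by auto
  define c where "c = 96 / \<delta>\<^sup>2 * exp (4 * E + 1)"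
  have c: "0 < c" using \<delta> by (simp add: c_def)
  define q where "q n = 1 / (1 + (of_int n :: real)\<^sup>2)" for n :: int
  have q: "0 \<le> q n" for n by (auto simp: q_def intro!: divide_nonneg_pos add_pos_nonneg)
  have "(\<Sum>l\<in>S. exp (- (2 * E + 1) * \<bar>Im l\<bar>) / (1 + (Re l - x)\<^sup>2)) \<le> c * (Z * Z)"
    if S: "finite S" "S \<subseteq> \<Lambda>" for S x
  proof -
    define \<phi> where "\<phi> l = (\<lfloor>Re l - x\<rfloor>, \<lfloor>Im l\<rfloor>)" for l
    have "(\<Sum>l\<in>S. exp (- (2 * E + 1) * \<bar>Im l\<bar>) / (1 + (Re l - x)\<^sup>2))
        = (\<Sum>p\<in>\<phi> ` S. \<Sum>l\<in>{l\<in>S. \<phi> l = p}. exp (- (2 * E + 1) * \<bar>Im l\<bar>) / (1 + (Re l - x)\<^sup>2))"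
      by (rule sum.image_gen[OF S(1)])
    also have "\<dots> \<le> (\<Sum>p\<in>\<phi> ` S. c * (q (fst p) * q (snd p)))"
      unfolding c_def q_def
      by (intro sum_mono exp_separated_cell_sum_le[OF sep \<delta> E]) (use S in \<open>auto simp: \<phi>_def\<close>)
    \<comment> \<open>The occupied cells are enlarged to a rectangle, so that the double sum
      factors.\<close>
    also have "\<dots> \<le> (\<Sum>p\<in>(fst ` \<phi> ` S) \<times> (snd ` \<phi> ` S). c * (q (fst p) * q (snd p)))"
    proof (intro sum_mono2)
      show "\<phi> ` S \<subseteq> (fst ` \<phi> ` S) \<times> (snd ` \<phi> ` S)" by (rule subset_fst_snd)
    qed (use S c q in \<open>auto intro!: mult_nonneg_nonneg\<close>)
    also have "\<dots> = c * (\<Sum>p\<in>(fst ` \<phi> ` S) \<times> (snd ` \<phi> ` S). q (fst p) * q (snd p))"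
      by (rule sum_distrib_left[symmetric])
    also have "(\<Sum>p\<in>(fst ` \<phi> ` S) \<times> (snd ` \<phi> ` S). q (fst p) * q (snd p))
        = (\<Sum>n\<in>fst ` \<phi> ` S. q n) * (\<Sum>m\<in>snd ` \<phi> ` S. q m)"
      by (simp only: sum_product sum.cartesian_product case_prod_unfold)
    also have "c * ((\<Sum>n\<in>fst ` \<phi> ` S. q n) * (\<Sum>m\<in>snd ` \<phi> ` S. q m)) \<le> c * (Z * Z)"
      using c Z S q by (intro mult_left_mono mult_mono) (auto simp: q_def intro: sum_nonneg)
    finally show ?thesis .
  qed
  then show ?thesis using c Z by (intro exI[of _ "c * (Z * Z)"]) simp
qed

subsection \<open>Localized interpolating functions\<close>

lemma norm_sin_le_exp_Im:
  fixes z :: complex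
  shows "norm (sin z) \<le> exp \<bar>Im z\<bar>"
proof -
  have "norm (sin z) \<le> (norm (exp (\<i> * z)) + norm (exp (- (\<i> * z)))) / 2"
    unfolding sin_exp_eq using norm_triangle_ineq4[of "exp (\<i> * z)" "exp (- (\<i> * z))"]
    by (simp add: norm_divide norm_mult)
  also have "\<dots> = (exp (- Im z) + exp (Im z)) / 2" by simp
  also have "\<dots> \<le> exp \<bar>Im z\<bar>"
  proof -
    have "exp (- Im z) + exp (Im z) \<le> exp \<bar>Im z\<bar> + exp \<bar>Im z\<bar>" by (intro add_mono) simp_all
    then show ?thesis by simp
  qed
  finally show ?thesis .
qed

lemma Im_bounded_sinc:
  obtains s where "Im_bounded (exp 2) 1 s" "\<And>z. sin z = z * s z" "s 0 = 1"
proof -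
  have sin: "Im_bounded 1 1 sin"
    using norm_sin_le_exp_Im by (simp add: Im_bounded_def holomorphic_on_sin)
  obtain s where "Im_bounded (1 * exp (2 * 1)) 1 s" "\<And>z. sin z = (z - 0) * s z" "s 0 = deriv sin (0::complex)"
    by (rule Im_bounded_quotient[OF sin, of 0]) (simp_all add: that)
  moreover have "deriv sin (0::complex) = 1" using DERIV_imp_deriv[OF DERIV_sin, of "0::complex"] by simp
  ultimately show ?thesis by (intro that[of s]) simp_all
qed

section \<open>Biorthogonal families: separation and localization\<close>

text \<open>Statement (c) with its constants as parameters; \<open>biorthogonal_family_iff\<close>
  recovers the literal form.\<close>

definition biorthogonal_family :: "real \<Rightarrow> real \<Rightarrow> real \<Rightarrow> complex set \<Rightarrow> (complex \<Rightarrow> complex \<Rightarrow> complex) \<Rightarrow> bool" where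
  "biorthogonal_family A B C \<Lambda> f \<longleftrightarrow>
     (\<forall>l\<in>\<Lambda>. Im_bounded (A * exp (B * \<bar>Im l\<bar>)) C (f l)) \<and>
     (\<forall>l\<in>\<Lambda>. \<forall>l'\<in>\<Lambda>. f l l' = (if l = l' then 1 else 0))"

text \<open>Dividing \<open>f l\<close> by its zero at \<open>l'\<close> gives
  \<open>1 = f l l = (l - l') * q l\<close>, and the bound on \<open>q l\<close> grows at most like
  \<open>exp ((B + C) * \<bar>Im l\<bar>)\<close>. The maximum in \<open>L\<close> ensures that
  \<open>1 / L \<le> 1\<close>.\<close>

lemma biorthogonal_family_exp_separated:
  assumes f: "biorthogonal_family A B C \<Lambda> f" and A: "0 < A" and B: "0 \<le> B" and C: "0 \<le> C"
  obtains \<delta> where "0 < \<delta>" "\<delta> \<le> 1" "exp_separated \<delta> (B + C) \<Lambda>"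
proof -
  define L where "L = max 1 (A * exp (2 * C))"
  have L: "1 \<le> L" "A * exp (2 * C) \<le> L" by (auto simp: L_def)
  have "1 / L * exp (- (B + C) * \<bar>Im l\<bar>) \<le> dist l l'"
    if l: "l \<in> \<Lambda>" "l' \<in> \<Lambda>" "l \<noteq> l'" for l l'
  proof -
    have fl: "Im_bounded (A * exp (B * \<bar>Im l\<bar>)) C (f l)" "f l l' = 0" "f l l = 1"
      using f l by (auto simp: biorthogonal_family_def)
    obtain q where q: "Im_bounded (A * exp (B * \<bar>Im l\<bar>) * exp (2 * C)) C q"
      "\<And>z. f l z = (z - l') * q z" "q l' = deriv (f l) l'"
      by (rule Im_bounded_quotient[OF fl(1) C fl(2)]) (rule that)
    have "norm (q l) \<le> A * exp (B * \<bar>Im l\<bar>) * exp (2 * C) * exp (C * \<bar>Im l\<bar>)"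
      by (rule Im_boundedD[OF q(1)])
    also have "\<dots> = (A * exp (2 * C)) * exp ((B + C) * \<bar>Im l\<bar>)"
      by (simp add: exp_add distrib_right)
    also have "\<dots> \<le> L * exp ((B + C) * \<bar>Im l\<bar>)"
      using L by (intro mult_right_mono) auto
    finally have ql: "norm (q l) \<le> L * exp ((B + C) * \<bar>Im l\<bar>)" .
    have "1 = dist l l' * norm (q l)"
      using q(2)[of l] fl(3) by (metis dist_norm norm_mult norm_one)
    also have "\<dots> \<le> dist l l' * (L * exp ((B + C) * \<bar>Im l\<bar>))"
      using ql by (intro mult_left_mono) auto
    finally have "1 \<le> dist l l' * (L * exp ((B + C) * \<bar>Im l\<bar>))" .
    moreover have "exp (- (B + C) * \<bar>Im l\<bar>) = 1 / exp ((B + C) * \<bar>Im l\<bar>)"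
      unfolding mult_minus_left exp_minus by (rule inverse_eq_divide)
    ultimately show ?thesis
      unfolding \<open>exp (- (B + C) * \<bar>Im l\<bar>) = _\<close> using L by (simp add: pos_divide_le_eq mult_ac)
  qed
  then have "exp_separated (1 / L) (B + C) \<Lambda>" by (simp add: exp_separated_def)
  then show ?thesis using L by (intro that[of "1 / L"]) auto
qed

text \<open>Values at the points are left open because the terms to be summed are
  \<open>v l * g l z\<close> in one case and \<open>(z - l) * (g l z)\<^sup>2\<close> in the
  other.\<close>

definition localized_family :: "real \<Rightarrow> real \<Rightarrow> real \<Rightarrow> complex set \<Rightarrow> (complex \<Rightarrow> complex \<Rightarrow> complex) \<Rightarrow> bool" where
  "localized_family K D C \<Lambda> h \<longleftrightarrow>
     (\<forall>l\<in>\<Lambda>. h l holomorphic_on UNIV \<and>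
       (\<forall>z. norm (h l z) * (1 + (norm (z - l))\<^sup>2) \<le> K * exp (- D * \<bar>Im l\<bar>) * exp (C * \<bar>Im z\<bar>)))"

text \<open>The factor \<open>exp (\<mp> \<i> D' (z - l))\<close>, with the sign of \<open>Im l\<close>, trades exponential type in \<open>z\<close> for
  decay in \<open>l\<close>; the factor \<open>(sin (z - l) / (z - l))\<^sup>2\<close> gives the decay in the real direction.\<close>

lemma biorthogonal_family_localize:
  assumes f: "biorthogonal_family A B C \<Lambda> f" and A: "0 < A" and B: "0 \<le> B" and C: "0 \<le> C" and D: "0 \<le> D"
  obtains g K C' where "0 < K" "0 < C'" "localized_family K D C' \<Lambda> g"
    "\<And>l l'. l \<in> \<Lambda> \<Longrightarrow> l' \<in> \<Lambda> \<Longrightarrow> g l l' = (if l = l' then 1 else 0)"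
proof -
  obtain s where s: "Im_bounded (exp 2) 1 s" "\<And>z. sin z = z * s z" "s 0 = 1"
    by (rule Im_bounded_sinc) (rule that)
  define \<sigma> where "\<sigma> l = (if 0 \<le> Im l then 1 else - 1 :: real)" for l
  \<comment> \<open>Of this decay rate in \<open>\<bar>Im l\<bar>\<close>, \<open>B\<close>
    compensates the growth of \<open>f l\<close>, 2 that of the squared sinc centred at
    \<open>l\<close>, and \<open>D\<close> remains.\<close>
  define D' where "D' = D + B + 2"
  \<comment> \<open>\<open>exp 4\<close> bounds the contribution of \<open>s w\<close> and 1 that of
    \<open>w * s w = sin w\<close>, after squaring and factoring out
    \<open>exp (2 * \<bar>Im w\<bar>)\<close>.\<close>
  define M where "M = exp 4 + (1::real)"
  define g where "g l z = f l z * exp (- \<i> * of_real (\<sigma> l * D') * (z - l)) * (s (z - l))\<^sup>2" for l z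
  define K where "K = A * M"
  define C' where "C' = C + D' + 2"
  have sinc: "(norm (s w))\<^sup>2 * (1 + (norm w)\<^sup>2) \<le> M * exp (2 * \<bar>Im w\<bar>)" for w
  proof -
    have "(norm (s w))\<^sup>2 \<le> (exp 2 * exp (1 * \<bar>Im w\<bar>))\<^sup>2"
      by (intro power_mono Im_boundedD[OF s(1)]) auto
    also have "\<dots> = exp 4 * exp (2 * \<bar>Im w\<bar>)"
      by (simp add: power_mult_distrib flip: exp_double)
    finally have "(norm (s w))\<^sup>2 \<le> exp 4 * exp (2 * \<bar>Im w\<bar>)" .
    moreover have "(norm (w * s w))\<^sup>2 \<le> (exp \<bar>Im w\<bar>)\<^sup>2"
      unfolding s(2)[symmetric] by (intro power_mono norm_sin_le_exp_Im) auto
    ultimately show ?thesis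
      by (simp add: M_def norm_mult power_mult_distrib algebra_simps flip: exp_double)
  qed
  have "norm (g l z) * (1 + (norm (z - l))\<^sup>2) \<le> K * exp (- D * \<bar>Im l\<bar>) * exp (C' * \<bar>Im z\<bar>)"
    if l: "l \<in> \<Lambda>" for l z
  proof -
    have fl: "norm (f l z) \<le> A * exp (B * \<bar>Im l\<bar>) * exp (C * \<bar>Im z\<bar>)"
      using f l by (auto simp: biorthogonal_family_def dest: Im_boundedD)
    have "\<sigma> l * (Im z - Im l) \<le> \<bar>Im z\<bar> - \<bar>Im l\<bar>" by (auto simp: \<sigma>_def)
    then have "D' * (\<sigma> l * (Im z - Im l)) \<le> D' * (\<bar>Im z\<bar> - \<bar>Im l\<bar>)"
      using B D by (intro mult_left_mono) (auto simp: D'_def)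
    then have e: "norm (exp (- \<i> * of_real (\<sigma> l * D') * (z - l))) \<le> exp (D' * (\<bar>Im z\<bar> - \<bar>Im l\<bar>))"
      by (simp add: norm_exp_eq_Re algebra_simps)
    have "M * exp (2 * \<bar>Im (z - l)\<bar>) \<le> M * exp (2 * (\<bar>Im z\<bar> + \<bar>Im l\<bar>))"
      using abs_triangle_ineq4[of "Im z" "Im l"] by (intro mult_left_mono) (auto simp: M_def)
    with sinc have ss: "(norm (s (z - l)))\<^sup>2 * (1 + (norm (z - l))\<^sup>2) \<le> M * exp (2 * (\<bar>Im z\<bar> + \<bar>Im l\<bar>))"
      by (rule order_trans)
    have "norm (g l z) * (1 + (norm (z - l))\<^sup>2)
        = (norm (f l z) * norm (exp (- \<i> * of_real (\<sigma> l * D') * (z - l))))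
          * ((norm (s (z - l)))\<^sup>2 * (1 + (norm (z - l))\<^sup>2))"
      by (simp only: g_def norm_mult norm_power mult.assoc)
    also have "\<dots> \<le> ((A * exp (B * \<bar>Im l\<bar>) * exp (C * \<bar>Im z\<bar>)) * exp (D' * (\<bar>Im z\<bar> - \<bar>Im l\<bar>)))
          * (M * exp (2 * (\<bar>Im z\<bar> + \<bar>Im l\<bar>)))"
      using A by (intro mult_mono[OF mult_mono[OF fl e] ss]) auto
    also have "\<dots> = K * (exp (B * \<bar>Im l\<bar>) * exp (C * \<bar>Im z\<bar>) * exp (D' * (\<bar>Im z\<bar> - \<bar>Im l\<bar>))
          * exp (2 * (\<bar>Im z\<bar> + \<bar>Im l\<bar>)))"
      by (simp only: K_def mult_ac)
    also have "\<dots> = K * (exp (- D * \<bar>Im l\<bar>) * exp (C' * \<bar>Im z\<bar>))"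
      unfolding exp_add[symmetric] by (simp add: C'_def D'_def algebra_simps)
    finally show ?thesis by (simp add: mult.assoc)
  qed
  moreover have "g l holomorphic_on UNIV" if l: "l \<in> \<Lambda>" for l
  proof -
    have "(s \<circ> (\<lambda>z. z - l)) holomorphic_on UNIV"
      by (intro holomorphic_on_compose_gen[OF _ Im_bounded_holomorphic[OF s(1)]] holomorphic_intros) auto
    moreover have "f l holomorphic_on UNIV"
      using f l by (auto simp: biorthogonal_family_def dest: Im_bounded_holomorphic)
    ultimately show ?thesis
      unfolding g_def o_def by (intro holomorphic_intros)
  qed
  ultimately have "localized_family K D C' \<Lambda> g" by (simp add: localized_family_def)
  moreover have "g l l' = (if l = l' then 1 else 0)" if "l \<in> \<Lambda>" "l' \<in> \<Lambda>" for l l'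
    using f that by (simp add: biorthogonal_family_def g_def s(3))
  moreover have "0 < K" "0 < C'"
    using A B C D by (auto simp: K_def M_def C'_def D'_def intro!: mult_pos_pos add_pos_pos)
  ultimately show ?thesis by (intro that[of K C' g])
qed

section \<open>Summation of localized families\<close>

lemma finite_discrete_sequence_Int_cball:
  assumes "discrete_sequence \<Lambda>"
  shows "finite (\<Lambda> \<inter> cball 0 r)"
proof (rule ccontr)
  assume "infinite (\<Lambda> \<inter> cball 0 r)"
  then obtain x where "x islimpt (\<Lambda> \<inter> cball 0 r)"
    using Heine_Borel_imp_Bolzano_Weierstrass[of "cball 0 r" "\<Lambda> \<inter> cball 0 r"] by auto
  then have "x islimpt \<Lambda>" by (rule islimpt_subset) auto
  with assms show False by (simp add: discrete_sequence_def)
qed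

lemma localized_family_sum:
  assumes \<Lambda>: "discrete_sequence \<Lambda>"
    and sep: "exp_separated \<delta> E \<Lambda>" and \<delta>: "0 < \<delta>" "\<delta> \<le> 1" and E: "0 \<le> E"
    and h: "localized_family K (2 * E + 1) C \<Lambda> h" and K: "0 < K" and C: "0 < C"
  obtains H r where "H \<in> Bernstein_algebra" "strict_mono (r :: nat \<Rightarrow> nat)"
    "\<And>z. (\<lambda>n. \<Sum>l\<in>\<Lambda> \<inter> cball 0 (real (r n)). h l z) \<longlonglongrightarrow> H z"
    "\<And>z. (\<lambda>n. \<Sum>l\<in>\<Lambda> \<inter> cball 0 (real (r n)). deriv (h l) z) \<longlonglongrightarrow> deriv H z"
proof -
  obtain M where M: "0 < M" "\<And>S x. finite S \<Longrightarrow> S \<subseteq> \<Lambda> \<Longrightarrow>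
      (\<Sum>l\<in>S. exp (- (2 * E + 1) * \<bar>Im l\<bar>) / (1 + (Re l - x)\<^sup>2)) \<le> M"
    using exp_separated_sum_bounded[OF sep \<delta> E] by auto
  define F where "F n z = (\<Sum>l\<in>\<Lambda> \<inter> cball 0 (real n). h l z)" for n :: nat and z
  have fin: "finite (\<Lambda> \<inter> cball 0 (real n))" for n :: nat
    by (rule finite_discrete_sequence_Int_cball[OF \<Lambda>])
  have hol: "h l holomorphic_on UNIV" if "l \<in> \<Lambda>" for l
    using h that by (simp add: localized_family_def)
  have hl: "norm (h l z) \<le> K * exp (C * \<bar>Im z\<bar>) * (exp (- (2 * E + 1) * \<bar>Im l\<bar>) / (1 + (Re l - Re z)\<^sup>2))"
    if l: "l \<in> \<Lambda>" for l z
  proof -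
    \<comment> \<open>Only the horizontal part of the distance is kept; vertical decay comes from
      the weight in \<open>Im l\<close>.\<close>
    have "(Re l - Re z)\<^sup>2 \<le> (norm (z - l))\<^sup>2"
      using abs_Re_le_cmod[of "z - l"] power_mono[of "\<bar>Re l - Re z\<bar>" "norm (z - l)" 2] by simp
    then have "norm (h l z) * (1 + (Re l - Re z)\<^sup>2) \<le> norm (h l z) * (1 + (norm (z - l))\<^sup>2)"
      by (intro mult_left_mono) auto
    also have "\<dots> \<le> K * exp (- (2 * E + 1) * \<bar>Im l\<bar>) * exp (C * \<bar>Im z\<bar>)"
      using h l by (simp add: localized_family_def)
    finally have "norm (h l z) * (1 + (Re l - Re z)\<^sup>2) \<le> K * exp (C * \<bar>Im z\<bar>) * exp (- (2 * E + 1) * \<bar>Im l\<bar>)"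
      by (simp add: mult_ac)
    moreover have "0 < 1 + (Re l - Re z)\<^sup>2" by (simp add: add_pos_nonneg)
    ultimately show ?thesis by (simp add: pos_le_divide_eq)
  qed
  have F: "Im_bounded (K * M) C (F n)" for n
    unfolding Im_bounded_def
  proof (intro conjI allI)
    show "F n holomorphic_on UNIV"
      unfolding F_def by (intro holomorphic_intros hol) auto
    fix z
    have "norm (F n z) \<le> (\<Sum>l\<in>\<Lambda> \<inter> cball 0 (real n).
        K * exp (C * \<bar>Im z\<bar>) * (exp (- (2 * E + 1) * \<bar>Im l\<bar>) / (1 + (Re l - Re z)\<^sup>2)))"
      unfolding F_def by (intro sum_norm_le hl) auto
    also have "\<dots> \<le> K * exp (C * \<bar>Im z\<bar>) * M"
      unfolding sum_distrib_left[symmetric] using K fin by (intro mult_left_mono M) auto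
    finally show "norm (F n z) \<le> K * M * exp (C * \<bar>Im z\<bar>)" by (simp add: mult_ac)
  qed
  obtain H r where H: "Im_bounded (K * M) C H" "strict_mono (r :: nat \<Rightarrow> nat)"
    "\<And>z. (\<lambda>n. F (r n) z) \<longlonglongrightarrow> H z" "\<And>z. (\<lambda>n. deriv (F (r n)) z) \<longlonglongrightarrow> deriv H z"
    by (rule Im_bounded_normal_family[of "K * M" C F, OF F]) (rule that)
  have "H \<in> Bernstein_algebra"
    using H(1) K C M(1) by (auto simp: Bernstein_algebra_iff_Im_bounded intro: mult_pos_pos)
  moreover have "deriv (F n) z = (\<Sum>l\<in>\<Lambda> \<inter> cball 0 (real n). deriv (h l) z)" for n z
  proof -
    have "(F n has_field_derivative (\<Sum>l\<in>\<Lambda> \<inter> cball 0 (real n). deriv (h l) z)) (at z)"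
      unfolding F_def by (intro DERIV_sum holomorphic_derivI[OF hol open_UNIV UNIV_I]) auto
    then show ?thesis by (rule DERIV_imp_deriv)
  qed
  ultimately show ?thesis
    using H by (intro that[of H r]) (simp_all add: F_def)
qed

text \<open>Once the ball contains \<open>l\<close>, the sum is the single term \<open>c l\<close>.
  Here \<open>c l'\<close> will be \<open>h l' l\<close> or \<open>deriv (h l') l\<close>.\<close>

lemma tendsto_biorthogonal_sum:
  fixes c :: "complex \<Rightarrow> complex"
  assumes \<Lambda>: "discrete_sequence \<Lambda>" and r: "strict_mono (r :: nat \<Rightarrow> nat)" and l: "l \<in> \<Lambda>"
    and c: "\<And>l'. l' \<in> \<Lambda> \<Longrightarrow> l' \<noteq> l \<Longrightarrow> c l' = 0"
  shows "(\<lambda>n. \<Sum>l'\<in>\<Lambda> \<inter> cball 0 (real (r n)). c l') \<longlonglongrightarrow> c l"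
proof (rule tendsto_eventually)
  obtain N :: nat where N: "norm l \<le> real N" using real_arch_simple by blast
  show "\<forall>\<^sub>F n in sequentially. (\<Sum>l'\<in>\<Lambda> \<inter> cball 0 (real (r n)). c l') = c l"
  proof (rule eventually_sequentiallyI)
    fix n assume "N \<le> n"
    then have "real N \<le> real (r n)" using seq_suble[OF r, of n] by simp
    then have "l \<in> \<Lambda> \<inter> cball 0 (real (r n))" using l N by simp
    then have "(\<Sum>l'\<in>\<Lambda> \<inter> cball 0 (real (r n)). c l') = (\<Sum>l'\<in>{l}. c l')"
      using c finite_discrete_sequence_Int_cball[OF \<Lambda>] by (intro sum.mono_neutral_right) auto
    then show "(\<Sum>l'\<in>\<Lambda> \<inter> cball 0 (real (r n)). c l') = c l" by simp
  qed
qed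

subsection \<open>Uniform interpolation of zero-one sequences\<close>

text \<open>Baire category for the compact space of subsets of \<open>\<Lambda>\<close>, by hand: by normality, failure to
  interpolate an indicator with bound \<open>N\<close> is already seen on a finite part of \<open>\<Lambda>\<close>, so if no
  cylinder admits a uniform bound then a set failing every bound is built step by step.\<close>

lemma uniform_bound_on_cylinder:
  fixes \<Lambda> :: "complex set"
  assumes interp: "\<And>X. \<exists>K C. \<exists>f. Im_bounded K C f \<and> (\<forall>l\<in>\<Lambda>. f l = of_bool (l \<in> X))"
  shows "\<exists>(N::nat) (n::nat) X0. \<forall>X. X \<inter> cball 0 n = X0 \<inter> cball 0 n \<longrightarrow>
    (\<exists>f. Im_bounded N N f \<and> (\<forall>l\<in>\<Lambda>. f l = of_bool (l \<in> X)))"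
proof (rule ccontr)
  \<comment> \<open>\<open>I N n X\<close> depends only on the part of \<open>X\<close> in the ball
    of radius \<open>n\<close>, so its failure persists when \<open>X\<close> is later changed
    outside that ball.\<close>
  define I where "I N n X \<longleftrightarrow>
    (\<exists>f. Im_bounded (real N) (real N) f \<and> (\<forall>l\<in>\<Lambda> \<inter> cball 0 (real n). f l = of_bool (l \<in> X)))"
    for N n :: nat and X
  define J where "J N X \<longleftrightarrow> (\<exists>f. Im_bounded (real N) (real N) f \<and> (\<forall>l\<in>\<Lambda>. f l = of_bool (l \<in> X)))"
    for N :: nat and X
  assume "\<not> ?thesis"
  then have "\<not> (\<exists>(N::nat) (n::nat) X0. \<forall>X. X \<inter> cball 0 (real n) = X0 \<inter> cball 0 (real n) \<longrightarrow> J N X)"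
    unfolding J_def .
  then have neg: "\<exists>X. X \<inter> cball 0 (real n) = X0 \<inter> cball 0 (real n) \<and> \<not> J N X" for N n X0
    by metis
  have I_all: "J N X"
    if all: "\<And>m. n \<le> m \<Longrightarrow> I N m X" for N n X
  proof -
    have "\<exists>f. Im_bounded (real N) (real N) f \<and>
        (\<forall>l\<in>\<Lambda> \<inter> cball 0 (real (n + k)). f l = of_bool (l \<in> X))" for k
      using all[of "n + k"] by (simp add: I_def)
    then obtain F where F: "\<And>k. Im_bounded (real N) (real N) (F k)"
      "\<And>k l. l \<in> \<Lambda> \<inter> cball 0 (real (n + k)) \<Longrightarrow> F k l = of_bool (l \<in> X)"
      by metis
    obtain f r where f: "Im_bounded (real N) (real N) f" "strict_mono (r :: nat \<Rightarrow> nat)"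
      "\<And>z. (\<lambda>k. F (r k) z) \<longlonglongrightarrow> f z" "\<And>z. (\<lambda>k. deriv (F (r k)) z) \<longlonglongrightarrow> deriv f z"
      by (rule Im_bounded_normal_family[of "real N" "real N" F, OF F(1)]) (rule that)
    have "f l = of_bool (l \<in> X)" if l: "l \<in> \<Lambda>" for l
    proof (rule LIMSEQ_unique[OF f(3)])
      obtain k0 :: nat where k0: "norm l \<le> real k0" using real_arch_simple by blast
      show "(\<lambda>k. F (r k) l) \<longlonglongrightarrow> of_bool (l \<in> X)"
      proof (rule tendsto_eventually, rule eventually_sequentiallyI)
        fix k assume "k0 \<le> k"
        then have "real k0 \<le> real (n + r k)" using seq_suble[OF f(2), of k] by simp
        then show "F (r k) l = of_bool (l \<in> X)" using l k0 by (intro F(2)) simp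
      qed
    qed
    with f(1) show ?thesis unfolding J_def by blast
  qed
  have step: "\<exists>X' m. n \<le> m \<and> X' \<inter> cball 0 (real n) = X \<inter> cball 0 (real n) \<and> \<not> I N m X'" for N n X
    using neg[of n X N] I_all by meson
  \<comment> \<open>A state is a set with the radius up to which it is frozen. Step \<open>k\<close>
    defeats the constant \<open>k\<close>, and the failure is recorded in state
    \<open>Suc k\<close>.\<close>
  have "\<exists>s :: nat \<Rightarrow> complex set \<times> nat. \<forall>k. True \<and> snd (s k) \<le> snd (s (Suc k)) \<and>
      fst (s (Suc k)) \<inter> cball 0 (real (snd (s k))) = fst (s k) \<inter> cball 0 (real (snd (s k))) \<and>
      \<not> I k (snd (s (Suc k))) (fst (s (Suc k)))"
    by (rule dependent_nat_choice) (use step in auto)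
  then obtain s where s: "\<And>k. snd (s k) \<le> snd (s (Suc k))"
      "\<And>k. fst (s (Suc k)) \<inter> cball 0 (real (snd (s k))) = fst (s k) \<inter> cball 0 (real (snd (s k)))"
      "\<And>k. \<not> I k (snd (s (Suc k))) (fst (s (Suc k)))"
    by auto
  define Y where "Y k = fst (s k)" for k
  define m where "m k = snd (s k)" for k
  have mono: "m k \<le> m j" if "k \<le> j" for k j
    using lift_Suc_mono_le[of m k j] s(1) that by (simp add: m_def)
  have Y: "Y j \<inter> cball 0 (real (m k)) = Y k \<inter> cball 0 (real (m k))" if "k \<le> j" for k j
    using that
  proof (induction rule: dec_induct)
    case (step j)
    have "Y (Suc j) \<inter> cball 0 (real (m j)) = Y j \<inter> cball 0 (real (m j))"
      using s(2) by (simp add: Y_def m_def)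
    moreover have "cball 0 (real (m k)) \<subseteq> (cball 0 (real (m j)) :: complex set)"
      using mono[of k j] step by (intro subset_cball) simp
    ultimately show ?case using step.IH by blast
  qed simp
  have Ymem: "l \<in> Y j \<longleftrightarrow> l \<in> Y k" if "k \<le> j" "norm l \<le> real (m k)" for k j l
    using Y[OF that(1)] that(2) by (metis Int_iff mem_cball_0)
  \<comment> \<open>The radii need not tend to infinity; taking the points that belong to all late
    \<open>Y j\<close> still gives a set agreeing with each \<open>Y k\<close> on its frozen
    ball.\<close>
  define X where "X = {l. \<exists>k. \<forall>j\<ge>k. l \<in> Y j}"
  have X: "l \<in> X \<longleftrightarrow> l \<in> Y k" if l: "norm l \<le> real (m k)" for k l
  proof
    assume "l \<in> X"
    then obtain i where "\<forall>j\<ge>i. l \<in> Y j" by (auto simp: X_def)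
    then have "l \<in> Y (max i k)" by simp
    then show "l \<in> Y k" using Ymem[of k "max i k" l] l by simp
  next
    assume "l \<in> Y k"
    then show "l \<in> X" unfolding X_def using Ymem[OF _ l] by blast
  qed
  obtain K C f where f: "Im_bounded K C f" "\<And>l. l \<in> \<Lambda> \<Longrightarrow> f l = of_bool (l \<in> X)"
    using interp[of X] by blast
  obtain N :: nat where N: "max K C \<le> real N" using real_arch_simple by blast
  have "Im_bounded (real N) (real N) f" using N by (intro Im_bounded_mono[OF f(1)]) auto
  moreover have "f l = of_bool (l \<in> Y (Suc N))" if "l \<in> \<Lambda> \<inter> cball 0 (real (m (Suc N)))" for l
    using f(2)[of l] X[of l "Suc N"] that by simp
  ultimately have "I N (m (Suc N)) (Y (Suc N))" by (auto simp: I_def)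
  with s(3)[of N] show False by (simp add: Y_def m_def)
qed

text \<open>For \<open>l\<close> outside the ball, both \<open>insert l X0\<close> and
  \<open>X0 - {l}\<close> lie in the cylinder. The finitely many points inside are treated one at a
  time through \<open>interp\<close>. The bound is uniform in \<open>l\<close>; the exponent 1 only
  gives it the shape of (c).\<close>

lemma uniform_bound_on_singletons:
  assumes \<Lambda>: "discrete_sequence \<Lambda>"
    and interp: "\<And>X. \<exists>K C. \<exists>f. Im_bounded K C f \<and> (\<forall>l\<in>\<Lambda>. f l = of_bool (l \<in> X))"
  obtains A C f where "0 < A" "0 < C" "biorthogonal_family A 1 C \<Lambda> f"
proof -
  obtain N n :: nat and X0 where cyl: "\<forall>X. X \<inter> cball 0 n = X0 \<inter> cball 0 n \<longrightarrow>
      (\<exists>f. Im_bounded N N f \<and> (\<forall>l\<in>\<Lambda>. f l = of_bool (l \<in> X)))"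
    using uniform_bound_on_cylinder[OF interp] by (elim exE) (rule that)
  define P where "P A C l \<longleftrightarrow> (\<exists>f. Im_bounded A C f \<and> (\<forall>l'\<in>\<Lambda>. f l' = (if l = l' then 1 else 0)))"
    for A C l
  have Pmono: "P A' C' l" if "P A C l" "A \<le> A'" "C \<le> C'" for A C A' C' l
    using that Im_bounded_mono unfolding P_def by blast
  have outer: "P (2 * real N) (real N) l" if l: "l \<notin> cball 0 n" for l
  proof -
    have "insert l X0 \<inter> cball 0 n = X0 \<inter> cball 0 n" "(X0 - {l}) \<inter> cball 0 n = X0 \<inter> cball 0 n"
      using l by auto
    note ex = this[THEN cyl[rule_format]]
    obtain f where f: "Im_bounded N N f" "\<forall>l'\<in>\<Lambda>. f l' = of_bool (l' \<in> insert l X0)"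
      using ex(1) by blast
    obtain g where g: "Im_bounded N N g" "\<forall>l'\<in>\<Lambda>. g l' = of_bool (l' \<in> X0 - {l})"
      using ex(2) by blast
    have "Im_bounded (2 * real N) (real N) (\<lambda>z. f z - g z)"
      using Im_bounded_diff[OF f(1) g(1)] by simp
    moreover have "f l' - g l' = (if l = l' then 1 else 0)" if "l' \<in> \<Lambda>" for l'
      using f(2) g(2) that by auto
    ultimately show ?thesis unfolding P_def by blast
  qed
  have "\<exists>M. P M M l" for l
  proof -
    obtain K C f where f: "Im_bounded K C f" "\<forall>l'\<in>\<Lambda>. f l' = of_bool (l' \<in> {l})"
      using interp[of "{l}"] by blast
    then have "P K C l" unfolding P_def by (intro exI[of _ f]) auto
    then show ?thesis by (intro exI[of _ "max K C"]) (rule Pmono, auto)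
  qed
  then obtain M where M: "\<And>l. P (M l) (M l) l" by metis
  \<comment> \<open>One number serves as both constants: \<open>2 * real N + 1\<close> covers the
    outer points and makes \<open>A\<close> positive, and the sum dominates every \<open>M l\<close>
    inside the ball.\<close>
  define A where "A = 2 * real N + 1 + (\<Sum>l\<in>\<Lambda> \<inter> cball 0 n. \<bar>M l\<bar>)"
  have A: "2 * real N + 1 \<le> A" by (auto simp: A_def intro: sum_nonneg)
  have P: "P A A l" if l: "l \<in> \<Lambda>" for l
  proof (cases "l \<in> cball 0 n")
    case True
    then have "\<bar>M l\<bar> \<le> (\<Sum>l\<in>\<Lambda> \<inter> cball 0 n. \<bar>M l\<bar>)"
      using l finite_discrete_sequence_Int_cball[OF \<Lambda>] by (intro member_le_sum) auto
    then have "M l \<le> A" by (simp add: A_def)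
    then show ?thesis by (intro Pmono[OF M])
  next
    case False
    then show ?thesis using A by (intro Pmono[OF outer]) auto
  qed
  then obtain f where f: "\<And>l. l \<in> \<Lambda> \<Longrightarrow> Im_bounded A A (f l)"
    "\<And>l l'. l \<in> \<Lambda> \<Longrightarrow> l' \<in> \<Lambda> \<Longrightarrow> f l l' = (if l = l' then 1 else 0)"
    unfolding P_def by metis
  have "Im_bounded (A * exp (1 * \<bar>Im l\<bar>)) A (f l)" if "l \<in> \<Lambda>" for l
    using A by (intro Im_bounded_mono[OF f(1)[OF that]]) (auto simp: mult_le_cancel_left1)
  then have "biorthogonal_family A 1 A \<Lambda> f" using f(2) by (simp add: biorthogonal_family_def)
  then show ?thesis using A by (intro that[of A A f]) auto
qed

subsection \<open>The equivalences\<close>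

lemma interpolation_imp_free_interpolation:
  assumes "interpolation_sequence \<Lambda>"
  shows "free_interpolation_sequence \<Lambda>"
  unfolding free_interpolation_sequence_def
proof (intro ballI allI impI)
  fix f and \<alpha> :: "complex \<Rightarrow> complex" assume f: "f \<in> Bernstein_algebra" and \<alpha>: "bounded (\<alpha> ` \<Lambda>)"
  obtain K C where K: "0 < K" "0 < C" "Im_bounded K C f"
    using f by (auto simp: Bernstein_algebra_iff_Im_bounded)
  obtain M where M: "0 < M" "\<And>l. l \<in> \<Lambda> \<Longrightarrow> norm (\<alpha> l) \<le> M"
    using \<alpha> by (auto simp: bounded_pos)
  have "norm (\<alpha> l * f l) * exp (- C * \<bar>Im l\<bar>) \<le> M * K" if l: "l \<in> \<Lambda>" for l
  proof -
    have "norm (\<alpha> l * f l) * exp (- C * \<bar>Im l\<bar>) \<le> (M * (K * exp (C * \<bar>Im l\<bar>))) * exp (- C * \<bar>Im l\<bar>)"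
      unfolding norm_mult using M K by (intro mult_right_mono mult_mono M l Im_boundedD) auto
    then show ?thesis by (simp add: exp_minus field_simps)
  qed
  then have "bdd_above ((\<lambda>l. norm (\<alpha> l * f l) * exp (- C * \<bar>Im l\<bar>)) ` \<Lambda>)"
    by (rule bdd_aboveI2)
  then show "\<exists>g\<in>Bernstein_algebra. \<forall>l\<in>\<Lambda>. g l = \<alpha> l * f l"
    using assms[unfolded interpolation_sequence_def, THEN spec, of "\<lambda>l. \<alpha> l * f l"] K(2) by blast
qed

lemma free_interpolation_imp_biorthogonal_family:
  assumes \<Lambda>: "discrete_sequence \<Lambda>" and free: "free_interpolation_sequence \<Lambda>"
  obtains A C f where "0 < A" "0 < C" "biorthogonal_family A 1 C \<Lambda> f"
proof (rule uniform_bound_on_singletons[OF \<Lambda> _ that])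
  fix X
  \<comment> \<open>Freeness is applied to the constant function 1, whose multiples are arbitrary
    bounded sequences.\<close>
  have "Im_bounded 1 1 (\<lambda>_. 1)" by (simp add: Im_bounded_def)
  then have 1: "(\<lambda>_. 1) \<in> Bernstein_algebra"
    unfolding Bernstein_algebra_iff_Im_bounded by (metis zero_less_one)
  have b: "bounded ((\<lambda>l. of_bool (l \<in> X) :: complex) ` \<Lambda>)"
    by (rule boundedI[of _ 1]) auto
  obtain g where g: "g \<in> Bernstein_algebra" "\<forall>l\<in>\<Lambda>. g l = of_bool (l \<in> X) * 1"
    using free[unfolded free_interpolation_sequence_def, rule_format, OF 1 b] by blast
  then obtain K C where "Im_bounded K C g" by (auto simp: Bernstein_algebra_iff_Im_bounded)
  with g(2) show "\<exists>K C. \<exists>f. Im_bounded K C f \<and> (\<forall>l\<in>\<Lambda>. f l = of_bool (l \<in> X))"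
    by (intro exI[of _ K] exI[of _ C] exI[of _ g]) simp
qed

lemma biorthogonal_family_imp_interpolation:
  assumes \<Lambda>: "discrete_sequence \<Lambda>" and f: "biorthogonal_family A B C \<Lambda> f"
    and A: "0 < A" and B: "0 \<le> B" and C: "0 \<le> C"
  shows "interpolation_sequence \<Lambda>"
  unfolding interpolation_sequence_def
proof (intro allI impI, elim exE conjE)
  fix v :: "complex \<Rightarrow> complex" and c :: real
  assume c: "0 < c" and "bdd_above ((\<lambda>l. norm (v l) * exp (- c * \<bar>Im l\<bar>)) ` \<Lambda>)"
  then obtain V0 where V0: "\<And>l. l \<in> \<Lambda> \<Longrightarrow> norm (v l) * exp (- c * \<bar>Im l\<bar>) \<le> V0"
    by (auto simp: bdd_above_def)
  define V where "V = max 1 V0"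
  have V: "0 < V" by (simp add: V_def)
  have v: "norm (v l) \<le> V * exp (c * \<bar>Im l\<bar>)" if "l \<in> \<Lambda>" for l
  proof -
    have "norm (v l) * exp (- c * \<bar>Im l\<bar>) \<le> V" using V0[OF that] by (simp add: V_def)
    then show ?thesis by (simp add: exp_minus field_simps)
  qed
  define E where "E = B + C"
  have E: "0 \<le> E" using B C by (simp add: E_def)
  obtain \<delta> where \<delta>: "0 < \<delta>" "\<delta> \<le> 1" "exp_separated \<delta> E \<Lambda>"
    by (rule biorthogonal_family_exp_separated[OF f A B C]) (rule that, simp_all add: E_def)
  \<comment> \<open>In the decay rate, \<open>c\<close> absorbs the growth of \<open>v\<close> and
    \<open>2 * E + 1\<close> is left for the summation.\<close>
  have "0 \<le> 2 * E + 1 + c" using E c by simp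
  then obtain g K C' where g: "0 < K" "0 < C'" "localized_family K (2 * E + 1 + c) C' \<Lambda> g"
    "\<And>l l'. l \<in> \<Lambda> \<Longrightarrow> l' \<in> \<Lambda> \<Longrightarrow> g l l' = (if l = l' then 1 else 0)"
    by (rule biorthogonal_family_localize[OF f A B C]) (rule that)
  define h where "h l z = v l * g l z" for l z
  have "norm (h l z) * (1 + (norm (z - l))\<^sup>2) \<le> (V * K) * exp (- (2 * E + 1) * \<bar>Im l\<bar>) * exp (C' * \<bar>Im z\<bar>)"
    if l: "l \<in> \<Lambda>" for l z
  proof -
    have "norm (h l z) * (1 + (norm (z - l))\<^sup>2) = norm (v l) * (norm (g l z) * (1 + (norm (z - l))\<^sup>2))"
      by (simp add: h_def norm_mult)
    also have "\<dots> \<le> (V * exp (c * \<bar>Im l\<bar>)) * (K * exp (- (2 * E + 1 + c) * \<bar>Im l\<bar>) * exp (C' * \<bar>Im z\<bar>))"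
    proof (rule mult_mono[OF v[OF l]])
      show "norm (g l z) * (1 + (norm (z - l))\<^sup>2)
          \<le> K * exp (- (2 * E + 1 + c) * \<bar>Im l\<bar>) * exp (C' * \<bar>Im z\<bar>)"
        using g(3) l unfolding localized_family_def by blast
    qed (use V in auto)
    also have "\<dots> = (V * K) * (exp (c * \<bar>Im l\<bar>) * exp (- (2 * E + 1 + c) * \<bar>Im l\<bar>)) * exp (C' * \<bar>Im z\<bar>)"
      by (simp only: mult_ac)
    also have "exp (c * \<bar>Im l\<bar>) * exp (- (2 * E + 1 + c) * \<bar>Im l\<bar>) = exp (- (2 * E + 1) * \<bar>Im l\<bar>)"
      unfolding exp_add[symmetric] by (simp add: algebra_simps)
    finally show ?thesis .
  qed
  moreover have "h l holomorphic_on UNIV" if "l \<in> \<Lambda>" for l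
    using g(3) that unfolding h_def localized_family_def by (intro holomorphic_intros) auto
  ultimately have h: "localized_family (V * K) (2 * E + 1) C' \<Lambda> h"
    by (simp add: localized_family_def)
  have VK: "0 < V * K" using V g(1) by simp
  obtain H r where H: "H \<in> Bernstein_algebra" "strict_mono (r :: nat \<Rightarrow> nat)"
    "\<And>z. (\<lambda>n. \<Sum>l\<in>\<Lambda> \<inter> cball 0 (real (r n)). h l z) \<longlonglongrightarrow> H z"
    "\<And>z. (\<lambda>n. \<Sum>l\<in>\<Lambda> \<inter> cball 0 (real (r n)). deriv (h l) z) \<longlonglongrightarrow> deriv H z"
    by (rule localized_family_sum[OF \<Lambda> \<delta>(3,1,2) E h VK g(2)]) (rule that)
  have "H l = v l" if l: "l \<in> \<Lambda>" for l
  proof (rule LIMSEQ_unique[OF H(3)])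
    have "(\<lambda>n. \<Sum>l'\<in>\<Lambda> \<inter> cball 0 (real (r n)). h l' l) \<longlonglongrightarrow> h l l"
      by (rule tendsto_biorthogonal_sum[OF \<Lambda> H(2) l]) (use l g(4) in \<open>auto simp: h_def\<close>)
    then show "(\<lambda>n. \<Sum>l'\<in>\<Lambda> \<inter> cball 0 (real (r n)). h l' l) \<longlonglongrightarrow> v l"
      using g(4) l by (simp add: h_def)
  qed
  with H(1) show "\<exists>f\<in>Bernstein_algebra. \<forall>l\<in>\<Lambda>. f l = v l" by blast
qed

text \<open>The square gives the term of index \<open>l\<close> a double zero at every other point,
  so it contributes nothing to the derivative there; with \<open>(z - l) * g l z\<close> alone the
  derivative \<open>(l' - l) * deriv (g l) l'\<close> would remain. At \<open>l\<close> itself the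
  derivative is \<open>(g l l)\<^sup>2 = 1\<close>.\<close>

lemma biorthogonal_family_imp_generator:
  assumes \<Lambda>: "discrete_sequence \<Lambda>" and f: "biorthogonal_family A B C \<Lambda> f"
    and A: "0 < A" and B: "0 \<le> B" and C: "0 \<le> C"
  obtains F where "F \<in> Bernstein_algebra" "\<And>l. l \<in> \<Lambda> \<Longrightarrow> F l = 0" "\<And>l. l \<in> \<Lambda> \<Longrightarrow> deriv F l = 1"
proof -
  define E where "E = B + C"
  have E: "0 \<le> E" using B C by (simp add: E_def)
  obtain \<delta> where \<delta>: "0 < \<delta>" "\<delta> \<le> 1" "exp_separated \<delta> E \<Lambda>"
    by (rule biorthogonal_family_exp_separated[OF f A B C]) (rule that, simp_all add: E_def)
  have "0 \<le> 2 * E + 1" using E by simp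
  then obtain g K C' where g: "0 < K" "0 < C'" "localized_family K (2 * E + 1) C' \<Lambda> g"
    "\<And>l l'. l \<in> \<Lambda> \<Longrightarrow> l' \<in> \<Lambda> \<Longrightarrow> g l l' = (if l = l' then 1 else 0)"
    by (rule biorthogonal_family_localize[OF f A B C]) (rule that)
  define h where "h l z = (z - l) * (g l z)\<^sup>2" for l z
  have hol: "g l holomorphic_on UNIV" if "l \<in> \<Lambda>" for l
    using g(3) that by (simp add: localized_family_def)
  have "norm (h l z) * (1 + (norm (z - l))\<^sup>2) \<le> K\<^sup>2 * exp (- (2 * E + 1) * \<bar>Im l\<bar>) * exp (2 * C' * \<bar>Im z\<bar>)"
    if l: "l \<in> \<Lambda>" for l z
  proof -
    define w where "w = norm (z - l)"
    have "0 \<le> w" "2 * w \<le> 1 + w\<^sup>2"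
      using zero_le_power2[of "w - 1"] by (simp_all add: power2_eq_square algebra_simps w_def)
    \<comment> \<open>One of the two quadratic decay factors of the square absorbs
      \<open>z - l\<close>, and the other is kept.\<close>
    then have "w \<le> 1 + w\<^sup>2" by linarith
    then have "norm (h l z) * (1 + w\<^sup>2) \<le> (1 + w\<^sup>2) * (norm (g l z))\<^sup>2 * (1 + w\<^sup>2)"
      unfolding h_def norm_mult norm_power w_def[symmetric]
      by (intro mult_right_mono) (auto simp: add_nonneg_nonneg)
    also have "\<dots> = (norm (g l z) * (1 + w\<^sup>2))\<^sup>2"
      by (simp add: power2_eq_square mult_ac)
    also have "\<dots> \<le> (K * exp (- (2 * E + 1) * \<bar>Im l\<bar>) * exp (C' * \<bar>Im z\<bar>))\<^sup>2"
    proof (intro power_mono)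
      show "norm (g l z) * (1 + w\<^sup>2) \<le> K * exp (- (2 * E + 1) * \<bar>Im l\<bar>) * exp (C' * \<bar>Im z\<bar>)"
        using g(3) l unfolding w_def localized_family_def by blast
    qed auto
    also have "\<dots> = K\<^sup>2 * (exp (- (2 * E + 1) * \<bar>Im l\<bar>) * exp (- (2 * E + 1) * \<bar>Im l\<bar>)) * exp (2 * C' * \<bar>Im z\<bar>)"
      by (simp add: power2_eq_square mult_exp_exp)
    also have "\<dots> \<le> K\<^sup>2 * (exp (- (2 * E + 1) * \<bar>Im l\<bar>) * 1) * exp (2 * C' * \<bar>Im z\<bar>)"
    proof (intro mult_right_mono mult_left_mono)
      show "exp (- (2 * E + 1) * \<bar>Im l\<bar>) \<le> 1"
        unfolding mult_minus_left exp_le_one_iff neg_le_0_iff_le using E by simp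
    qed auto
    finally show ?thesis by (simp add: w_def)
  qed
  moreover have hhol: "h l holomorphic_on UNIV" if "l \<in> \<Lambda>" for l
    unfolding h_def by (intro holomorphic_intros hol that)
  ultimately have h: "localized_family (K\<^sup>2) (2 * E + 1) (2 * C') \<Lambda> h"
    by (simp add: localized_family_def)
  have K2: "0 < K\<^sup>2" "0 < 2 * C'" using g(1,2) by simp_all
  obtain H r where H: "H \<in> Bernstein_algebra" "strict_mono (r :: nat \<Rightarrow> nat)"
    "\<And>z. (\<lambda>n. \<Sum>l\<in>\<Lambda> \<inter> cball 0 (real (r n)). h l z) \<longlonglongrightarrow> H z"
    "\<And>z. (\<lambda>n. \<Sum>l\<in>\<Lambda> \<inter> cball 0 (real (r n)). deriv (h l) z) \<longlonglongrightarrow> deriv H z"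
    by (rule localized_family_sum[OF \<Lambda> \<delta>(3,1,2) E h K2]) (rule that)
  have dh: "deriv (h l') l = (if l' = l then 1 else 0)" if l: "l \<in> \<Lambda>" "l' \<in> \<Lambda>" for l l'
  proof (rule DERIV_imp_deriv)
    have "(g l' has_field_derivative deriv (g l') l) (at l)"
      by (rule holomorphic_derivI[OF hol[OF l(2)] open_UNIV UNIV_I])
    then have "(h l' has_field_derivative (g l' l)\<^sup>2 + (l - l') * (2 * g l' l * deriv (g l') l)) (at l)"
      unfolding h_def by (auto intro!: derivative_eq_intros)
    then show "(h l' has_field_derivative (if l' = l then 1 else 0)) (at l)"
      using g(4)[OF l(2,1)] by (cases "l' = l") simp_all
  qed
  have "H l = 0" if l: "l \<in> \<Lambda>" for l
  proof (rule LIMSEQ_unique[OF H(3)])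
    have "(\<lambda>n. \<Sum>l'\<in>\<Lambda> \<inter> cball 0 (real (r n)). h l' l) \<longlonglongrightarrow> h l l"
      by (rule tendsto_biorthogonal_sum[OF \<Lambda> H(2) l]) (use l g(4) in \<open>auto simp: h_def\<close>)
    then show "(\<lambda>n. \<Sum>l'\<in>\<Lambda> \<inter> cball 0 (real (r n)). h l' l) \<longlonglongrightarrow> 0"
      by (simp add: h_def)
  qed
  moreover have "deriv H l = 1" if l: "l \<in> \<Lambda>" for l
  proof (rule LIMSEQ_unique[OF H(4)])
    have "(\<lambda>n. \<Sum>l'\<in>\<Lambda> \<inter> cball 0 (real (r n)). deriv (h l') l) \<longlonglongrightarrow> deriv (h l) l"
      by (rule tendsto_biorthogonal_sum[OF \<Lambda> H(2) l]) (use l dh in auto)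
    then show "(\<lambda>n. \<Sum>l'\<in>\<Lambda> \<inter> cball 0 (real (r n)). deriv (h l') l) \<longlonglongrightarrow> 1"
      using dh[OF l l] by simp
  qed
  ultimately show ?thesis using H(1) by (intro that[of H]) auto
qed

text \<open>The exponent \<open>B\<close> of the lower bound on the derivative becomes the exponent
  in \<open>Im l\<close>; the constant \<open>1 / d\<close> has type 0, so the \<open>C\<close> of
  \<open>F\<close> is kept for all \<open>l\<close>.\<close>

lemma generator_imp_biorthogonal_family:
  assumes F: "F \<in> Bernstein_algebra" and \<epsilon>: "0 < \<epsilon>" and B: "0 < B"
    and zero: "\<And>l. l \<in> \<Lambda> \<Longrightarrow> F l = 0"
    and deriv: "\<And>l. l \<in> \<Lambda> \<Longrightarrow> \<epsilon> * exp (- B * \<bar>Im l\<bar>) \<le> norm (deriv F l)"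
  obtains A C f where "0 < A" "0 < C" "biorthogonal_family A B C \<Lambda> f"
proof -
  obtain K C where K: "0 < K" "0 < C" "Im_bounded K C F"
    using F by (auto simp: Bernstein_algebra_iff_Im_bounded)
  define A where "A = K * exp (2 * C) / \<epsilon>"
  have "\<exists>f. Im_bounded (A * exp (B * \<bar>Im l\<bar>)) C f \<and> (\<forall>l'\<in>\<Lambda>. f l' = (if l = l' then 1 else 0))"
    if l: "l \<in> \<Lambda>" for l
  proof -
    have C0: "0 \<le> C" using K(2) by simp
    obtain q where q: "Im_bounded (K * exp (2 * C)) C q" "\<And>z. F z = (z - l) * q z" "q l = deriv F l"
      by (rule Im_bounded_quotient[OF K(3) C0 zero[OF l]]) (rule that)
    define d where "d = deriv F l"
    have e: "0 < \<epsilon> * exp (- B * \<bar>Im l\<bar>)" using \<epsilon> by simp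
    have d: "\<epsilon> * exp (- B * \<bar>Im l\<bar>) \<le> norm d" using deriv[OF l] by (simp add: d_def)
    with e have d0: "d \<noteq> 0" by (metis norm_zero not_le)
    have "norm (1 / d) \<le> 1 / (\<epsilon> * exp (- B * \<bar>Im l\<bar>))"
      unfolding norm_divide norm_one using d e \<epsilon> d0 by (intro divide_left_mono mult_pos_pos) auto
    also have "\<dots> = exp (B * \<bar>Im l\<bar>) / \<epsilon>" using \<epsilon> by (simp add: exp_minus field_simps)
    finally have "Im_bounded (exp (B * \<bar>Im l\<bar>) / \<epsilon>) 0 (\<lambda>_. 1 / d)"
      by (simp add: Im_bounded_def)
    from Im_bounded_mult[OF q(1) this]
    have "Im_bounded (A * exp (B * \<bar>Im l\<bar>)) C (\<lambda>z. q z * (1 / d))"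
      by (simp add: A_def)
    moreover have "q l' * (1 / d) = (if l = l' then 1 else 0)" if "l' \<in> \<Lambda>" for l'
      using zero[OF that] q(2)[of l'] q(3) d0 by (auto simp: d_def)
    ultimately show ?thesis by blast
  qed
  then obtain f where "\<And>l. l \<in> \<Lambda> \<Longrightarrow> Im_bounded (A * exp (B * \<bar>Im l\<bar>)) C (f l)"
    "\<And>l l'. l \<in> \<Lambda> \<Longrightarrow> l' \<in> \<Lambda> \<Longrightarrow> f l l' = (if l = l' then 1 else 0)"
    by metis
  then have "biorthogonal_family A B C \<Lambda> f" by (simp add: biorthogonal_family_def)
  moreover have "0 < A" using K \<epsilon> by (simp add: A_def)
  ultimately show ?thesis using K(2) by (intro that[of A C f])
qed

text \<open>In the presence of the bound, membership in the algebra amounts to holomorphy.\<close>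

lemma biorthogonal_family_iff:
  assumes "0 < A" "0 < C"
  shows "biorthogonal_family A B C \<Lambda> f \<longleftrightarrow>
     (\<forall>l\<in>\<Lambda>. f l \<in> Bernstein_algebra) \<and>
     (\<forall>l\<in>\<Lambda>. \<forall>l'\<in>\<Lambda>. f l l' = (if l = l' then 1 else 0)) \<and>
     (\<forall>l\<in>\<Lambda>. \<forall>z. norm (f l z) * exp (- C * \<bar>Im z\<bar>) \<le> A * exp (B * \<bar>Im l\<bar>))"
proof -
  have eq: "norm (f l z) * exp (- C * \<bar>Im z\<bar>) \<le> M \<longleftrightarrow> norm (f l z) \<le> M * exp (C * \<bar>Im z\<bar>)" for l z M
    by (simp add: exp_minus field_simps)
  have "f l \<in> Bernstein_algebra" if "Im_bounded (A * exp (B * \<bar>Im l\<bar>)) C (f l)" for l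
    using that assms unfolding Bernstein_algebra_iff_Im_bounded
    by (intro exI[of _ "A * exp (B * \<bar>Im l\<bar>)"] conjI exI[of _ C]) auto
  moreover have "f l holomorphic_on UNIV" if "f l \<in> Bernstein_algebra" for l
    using that by (simp add: Bernstein_algebra_def)
  ultimately show ?thesis
    unfolding biorthogonal_family_def eq Im_bounded_def by blast
qed

theorem theoremA:
  fixes \<Lambda> :: "complex set"
  assumes "discrete_sequence \<Lambda>"
  shows
    "(interpolation_sequence \<Lambda> \<longleftrightarrow> free_interpolation_sequence \<Lambda>)
     \<and>
     (interpolation_sequence \<Lambda> \<longleftrightarrow>
       (\<exists>A>0. \<exists>B>0. \<exists>C>0. \<exists>f :: complex \<Rightarrow> complex \<Rightarrow> complex.
          (\<forall>l\<in>\<Lambda>. f l \<in> Bernstein_algebra) \<and>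
          (\<forall>l\<in>\<Lambda>. \<forall>l'\<in>\<Lambda>. f l l' = (if l = l' then 1 else 0)) \<and>
          (\<forall>l\<in>\<Lambda>. \<forall>z. norm (f l z) * exp (- C * \<bar>Im z\<bar>) \<le> A * exp (B * \<bar>Im l\<bar>))))
     \<and>
     (interpolation_sequence \<Lambda> \<longleftrightarrow>
       (\<exists>F\<in>Bernstein_algebra. \<exists>\<epsilon>>0. \<exists>C>0. \<forall>l\<in>\<Lambda>.
          F l = 0 \<and> norm (deriv F l) \<ge> \<epsilon> * exp (- C * \<bar>Im l\<bar>)))"
  (is "(?a \<longleftrightarrow> ?b) \<and> (?a \<longleftrightarrow> ?c) \<and> (?a \<longleftrightarrow> ?d)")
proof -
  have ab: "?b" if "?a"
    using that by (rule interpolation_imp_free_interpolation)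
  have bc: "?c" if b: "?b"
  proof -
    obtain A C f where f: "0 < A" "0 < C" "biorthogonal_family A 1 C \<Lambda> f"
      by (rule free_interpolation_imp_biorthogonal_family[OF assms b]) (rule that)
    then show ?thesis
      unfolding biorthogonal_family_iff[OF f(1,2)]
      by (intro exI[of _ A] conjI exI[of _ 1] exI[of _ C] exI[of _ f]) auto
  qed
  have c: "\<exists>A>0. \<exists>B>0. \<exists>C>0. \<exists>f. biorthogonal_family A B C \<Lambda> f" if "?c"
    using that by (elim exE conjE) (metis biorthogonal_family_iff)
  have ca: "?a" if "?c"
    using c[OF that] biorthogonal_family_imp_interpolation[OF assms] less_imp_le by metis
  have cd: "?d" if "?c"
  proof -
    obtain A B C f where f: "0 < A" "0 < B" "0 < C" "biorthogonal_family A B C \<Lambda> f"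
      using c[OF \<open>?c\<close>] by blast
    obtain F where F: "F \<in> Bernstein_algebra" "\<And>l. l \<in> \<Lambda> \<Longrightarrow> F l = 0" "\<And>l. l \<in> \<Lambda> \<Longrightarrow> deriv F l = 1"
      by (rule biorthogonal_family_imp_generator[OF assms f(4)]) (use f that in auto)
    then show ?thesis
      by (intro bexI[of _ F] exI[of _ 1] conjI ballI) auto
  qed
  have dc: "?c" if d: "?d"
  proof -
    obtain F where F: "F \<in> Bernstein_algebra" and ex: "\<exists>\<epsilon>>0. \<exists>C>0. \<forall>l\<in>\<Lambda>.
        F l = 0 \<and> norm (deriv F l) \<ge> \<epsilon> * exp (- C * \<bar>Im l\<bar>)"
      using d by (elim bexE) (rule that)
    obtain \<epsilon> B where \<epsilon>: "0 < \<epsilon>" and B: "0 < B" and zero: "\<And>l. l \<in> \<Lambda> \<Longrightarrow> F l = 0"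
      and deriv: "\<And>l. l \<in> \<Lambda> \<Longrightarrow> \<epsilon> * exp (- B * \<bar>Im l\<bar>) \<le> norm (deriv F l)"
      using ex by blast
    obtain A C f where f: "0 < A" "0 < C" "biorthogonal_family A B C \<Lambda> f"
      by (rule generator_imp_biorthogonal_family[OF F \<epsilon> B zero deriv]) (assumption | rule that)+
    then show ?thesis
      using B unfolding biorthogonal_family_iff[OF f(1,2)]
      by (intro exI[of _ A] conjI exI[of _ B] exI[of _ C] exI[of _ f]) auto
  qed
  show ?thesis using ab bc ca cd dc by argo
qed

end
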